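(* Assume the Uniformity Conjecture and the special case of the Lander--Parkin--Selfridge conjecture, both stated in the context. Then there is an absolute constant $C'$ such that $$M_{\le d}(n)\le C'\left(\frac{d}{\log d}\right)^2$$ for all integers $d,n$ with $2\le d<\infty$ and $n\ne0$. In particular, there is an absolute constant $C''$ such that $\widetilde f(x)\le C''(\log x/\log\log x)^2$ for all sufficiently large real $x$.
   Context: Uniformity Conjecture (Caporaso--Harris--Mazur): for each integer $g\ge2$ there is a constant $C_g$ such that every (smooth, projective, geometrically irreducible) curve of genus $g$ defined over $\mathbb{Q}$ has at most $C_g$ rational points over $\mathbb{Q}$. Conjecture (Lander--Parkin--Selfridge, special case): if $k\ge25$ is an integer, then there do not exist distinct positive integers $a_1,b_1,\ldots,a_{12},b_{12}$ such that $\sum_{i=1}^{12}a_i^k=\sum_{i=1}^{12}b_i^k$. $\mathbb{N}$ denotes the set of positive integers. For an integer $d\ge2$, $V_d=\{x^k:x,k\in\mathbb{N},\ 2\le k\le d\}$, and $V_\infty=\{x^k:x,k\in\mathbb{N},\ k\ge2\}$. For $2\le d\le\infty$ and a nonzero integer $n$, a set $A\subseteq\mathbb{N}$ has property $D_{\le d}(n)$ if $ab+n\in V_d$ for all $a,b\in A$ with $a\ne b$; $M_{\le d}(n)=\sup\{|A|:A\subseteq\mathbb{N}\text{ has property }D_{\le d}(n)\}$. For real $x\ge1$, $\widetilde f(x)=\max\{|A|:A\subseteq[1,x]\cap\mathbb{N}\text{ has property }D_{\le\infty}(n)\text{ for some integer }n\text{ with }1\le|n|\le x\}$. *)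

theory Defs
  imports
    "HOL-Analysis.Analysis"
    "HOL-Library.Poly_Mapping"
    "HOL-Library.Function_Algebras"
    "HOL-Library.Extended_Nat"
    "HOL-Computational_Algebra.Polynomial"
begin

section \<open>Multivariate polynomials\<close>

text \<open>
  A monomial is a finitely supported exponent vector and a polynomial is a finitely supported
  family of coefficients, so that the ring structure is that of \<^theory>\<open>HOL-Library.Poly_Mapping\<close>.
\<close>

type_synonym 'a mvpoly = "(nat \<Rightarrow>\<^sub>0 nat) \<Rightarrow>\<^sub>0 'a"

definition total_deg :: "(nat \<Rightarrow>\<^sub>0 nat) \<Rightarrow> nat" where
  "total_deg t = (\<Sum>i\<in>Poly_Mapping.keys t. Poly_Mapping.lookup t i)"

text \<open>The polynomial ring \<open>K[x\<^sub>0, \<dots>, x\<^sub>N]\<close>.\<close>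

definition polys :: "nat \<Rightarrow> 'a::zero mvpoly set" where
  "polys N = {p. \<forall>t\<in>Poly_Mapping.keys p. Poly_Mapping.keys t \<subseteq> {..N}}"

text \<open>Its homogeneous part of degree \<open>m\<close>; the zero polynomial belongs to every degree.\<close>

definition forms :: "nat \<Rightarrow> nat \<Rightarrow> 'a::zero mvpoly set" where
  "forms N m = {p \<in> polys N. \<forall>t\<in>Poly_Mapping.keys p. total_deg t = m}"

definition eval_mvpoly :: "'a::comm_semiring_1 mvpoly \<Rightarrow> (nat \<Rightarrow> 'a) \<Rightarrow> 'a" where
  "eval_mvpoly p v =
     (\<Sum>t\<in>Poly_Mapping.keys p.
        Poly_Mapping.lookup p t * (\<Prod>i\<in>Poly_Mapping.keys t. v i ^ Poly_Mapping.lookup t i))"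

text \<open>
  The exponent subtraction below is truncated, but a monomial not involving \<open>x\<^sub>i\<close> gets
  coefficient \<open>0\<close>.
\<close>

definition partial_deriv :: "nat \<Rightarrow> 'a::comm_semiring_1 mvpoly \<Rightarrow> 'a mvpoly" where
  "partial_deriv i p =
     (\<Sum>t\<in>Poly_Mapping.keys p.
        Poly_Mapping.single (t - Poly_Mapping.single i 1)
          (of_nat (Poly_Mapping.lookup t i) * Poly_Mapping.lookup p t))"

definition complexify :: "rat mvpoly \<Rightarrow> complex mvpoly" where
  "complexify p = Poly_Mapping.map of_rat p"

definition mvpoly_scale :: "'a::comm_ring_1 \<Rightarrow> 'a mvpoly \<Rightarrow> 'a mvpoly" where
  "mvpoly_scale c p = Poly_Mapping.single 0 c * p"

lemma vector_space_mvpoly_scale: "vector_space (mvpoly_scale :: 'a::field \<Rightarrow> _)"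
  by unfold_locales
     (simp_all add: mvpoly_scale_def algebra_simps single_add mult_single mult.assoc [symmetric])

definition coord_scale :: "'a::field \<Rightarrow> (nat \<Rightarrow> 'a) \<Rightarrow> nat \<Rightarrow> 'a" where
  "coord_scale c v = (\<lambda>i. c * v i)"

lemma vector_space_coord_scale: "vector_space (coord_scale :: 'a::field \<Rightarrow> _)"
  by unfold_locales (simp_all add: coord_scale_def fun_eq_iff algebra_simps)


section \<open>Projective schemes over the rationals\<close>

text \<open>
  Homogeneous coordinates of a point of \<open>\<P>\<^sup>N(K)\<close> are nonzero functions vanishing beyond index
  \<open>N\<close>; the point itself is the class of such a function up to nonzero scalars.
\<close>

definition affine_cone :: "nat \<Rightarrow> 'a::field mvpoly set \<Rightarrow> (nat \<Rightarrow> 'a) set" where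
  "affine_cone N F =
     {v. (\<forall>i>N. v i = 0) \<and> v \<noteq> (\<lambda>_. 0) \<and> (\<forall>f\<in>F. eval_mvpoly f v = 0)}"

definition proj_point :: "(nat \<Rightarrow> 'a::field) \<Rightarrow> (nat \<Rightarrow> 'a) set" where
  "proj_point v = {coord_scale c v | c. c \<noteq> 0}"

definition proj_zeros :: "nat \<Rightarrow> 'a::field mvpoly set \<Rightarrow> (nat \<Rightarrow> 'a) set set" where
  "proj_zeros N F = proj_point ` affine_cone N F"

definition homogeneous_set :: "nat \<Rightarrow> 'a::zero mvpoly set \<Rightarrow> bool" where
  "homogeneous_set N F \<longleftrightarrow> F \<subseteq> (\<Union>m. forms N m)"

text \<open>
  A finite homogeneous set \<open>F\<close> in \<open>\<rat>[x\<^sub>0, \<dots>, x\<^sub>N]\<close> stands for the closed subscheme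
  \<open>X = Proj \<rat>[x\<^sub>0, \<dots>, x\<^sub>N]/(F)\<close> of \<open>\<P>\<^sup>N\<close> over \<open>\<rat>\<close>. All projective schemes over \<open>\<rat>\<close> arise in
  this way.
\<close>

definition rational_points :: "nat \<Rightarrow> rat mvpoly set \<Rightarrow> (nat \<Rightarrow> rat) set set" where
  "rational_points N F = proj_zeros N F"

definition complex_points :: "nat \<Rightarrow> rat mvpoly set \<Rightarrow> (nat \<Rightarrow> complex) set set" where
  "complex_points N F = proj_zeros N (complexify ` F)"

text \<open>Irreducibility of a subset of \<open>\<P>\<^sup>N(K)\<close> in the Zariski topology.\<close>

definition zariski_irreducible :: "nat \<Rightarrow> (nat \<Rightarrow> 'a::field) set set \<Rightarrow> bool" where
  "zariski_irreducible N X \<longleftrightarrow>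
     X \<noteq> {} \<and>
     (\<forall>G H. homogeneous_set N G \<and> homogeneous_set N H \<and>
            X \<subseteq> proj_zeros N G \<union> proj_zeros N H \<longrightarrow>
            X \<subseteq> proj_zeros N G \<or> X \<subseteq> proj_zeros N H)"

text \<open>
  Geometric irreducibility may be tested over any one algebraically closed extension of \<open>\<rat>\<close>;
  we use \<open>\<complex>\<close>.
\<close>

definition geometrically_irreducible :: "nat \<Rightarrow> rat mvpoly set \<Rightarrow> bool" where
  "geometrically_irreducible N F \<longleftrightarrow> zariski_irreducible N (complex_points N F)"

definition gen_ideal :: "nat \<Rightarrow> 'a::comm_ring_1 mvpoly set \<Rightarrow> 'a mvpoly set" where
  "gen_ideal N F = {\<Sum>f\<in>F. h f * f | h. \<forall>f\<in>F. h f \<in> polys N}"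

text \<open>
  \<open>dim S\<^sub>m - dim (I \<inter> S\<^sub>m) = dim (S/I)\<^sub>m\<close> where \<open>S = \<rat>[x\<^sub>0, \<dots>, x\<^sub>N]\<close> and \<open>I = (F)\<close>; all spaces here
  are finite-dimensional, so the subtraction of naturals is never truncated.
\<close>

definition hilbert_function :: "nat \<Rightarrow> rat mvpoly set \<Rightarrow> nat \<Rightarrow> nat" where
  "hilbert_function N F m =
     vector_space.dim mvpoly_scale (forms N m :: rat mvpoly set) -
     vector_space.dim mvpoly_scale (gen_ideal N F \<inter> forms N m)"

definition is_hilbert_polynomial :: "nat \<Rightarrow> rat mvpoly set \<Rightarrow> rat poly \<Rightarrow> bool" where
  "is_hilbert_polynomial N F P \<longleftrightarrow>
     (\<forall>\<^sub>F m in sequentially. of_nat (hilbert_function N F m) = poly P (of_nat m))"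

text \<open>The dimension of a nonempty projective scheme is the degree of its Hilbert polynomial.\<close>

definition has_dimension :: "nat \<Rightarrow> rat mvpoly set \<Rightarrow> nat \<Rightarrow> bool" where
  "has_dimension N F r \<longleftrightarrow> (\<exists>P. is_hilbert_polynomial N F P \<and> P \<noteq> 0 \<and> degree P = r)"

text \<open>
  The arithmetic genus \<open>(-1)\<^sup>r (P(0) - 1)\<close> with \<open>r = dim X\<close>. For a smooth, projective,
  geometrically irreducible curve it is the dimension of the space of global regular
  differentials, that is, the genus.
\<close>

definition has_arithmetic_genus :: "nat \<Rightarrow> rat mvpoly set \<Rightarrow> int \<Rightarrow> bool" where
  "has_arithmetic_genus N F g \<longleftrightarrow>
     (\<exists>P. is_hilbert_polynomial N F P \<and> P \<noteq> 0 \<and>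
          of_int g = (- 1) ^ degree P * (poly P 0 - 1))"

definition gradient :: "nat \<Rightarrow> 'a::field mvpoly \<Rightarrow> (nat \<Rightarrow> 'a) \<Rightarrow> nat \<Rightarrow> 'a" where
  "gradient N f v = (\<lambda>i. if i \<le> N then eval_mvpoly (partial_deriv i f) v else 0)"

definition jacobian_rank :: "nat \<Rightarrow> 'a::field mvpoly set \<Rightarrow> (nat \<Rightarrow> 'a) \<Rightarrow> nat" where
  "jacobian_rank N F v = vector_space.dim coord_scale ((\<lambda>f. gradient N f v) ` F)"

text \<open>
  The Jacobian criterion for smoothness of relative dimension \<open>r\<close>: the Jacobian matrix has rank
  \<open>N - r\<close> at every geometric point. It is meant for schemes all of whose components have
  dimension \<open>r\<close>.
\<close>

definition smooth_of_dim :: "nat \<Rightarrow> rat mvpoly set \<Rightarrow> nat \<Rightarrow> bool" where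
  "smooth_of_dim N F r \<longleftrightarrow>
     (\<forall>v\<in>affine_cone N (complexify ` F). jacobian_rank N (complexify ` F) v + r = N)"

definition smooth_projective_curve :: "nat \<Rightarrow> rat mvpoly set \<Rightarrow> bool" where
  "smooth_projective_curve N F \<longleftrightarrow>
     finite F \<and> homogeneous_set N F \<and>
     geometrically_irreducible N F \<and> has_dimension N F 1 \<and> smooth_of_dim N F 1"


section \<open>The two conjectures\<close>

definition uniformity_conjecture :: bool where
  "uniformity_conjecture \<longleftrightarrow>
     (\<forall>g::nat. g \<ge> 2 \<longrightarrow>
        (\<exists>C::nat. \<forall>N F. smooth_projective_curve N F \<and> has_arithmetic_genus N F (int g) \<longrightarrow>
            finite (rational_points N F) \<and> card (rational_points N F) \<le> C))"

definition lander_parkin_selfridge_special :: bool where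
  "lander_parkin_selfridge_special \<longleftrightarrow>
     (\<forall>k::nat. k \<ge> 25 \<longrightarrow>
        \<not> (\<exists>a b :: nat \<Rightarrow> nat.
              (\<forall>i\<in>{1..12}. a i > 0 \<and> b i > 0) \<and>
              inj_on a {1..12} \<and> inj_on b {1..12} \<and> a ` {1..12} \<inter> b ` {1..12} = {} \<and>
              (\<Sum>i=1..12. a i ^ k) = (\<Sum>i=1..12. b i ^ k)))"


section \<open>Diophantine tuples with values in perfect powers\<close>

definition V :: "enat \<Rightarrow> nat set" where
  "V d = {x ^ k | x k :: nat. x \<ge> 1 \<and> 2 \<le> k \<and> enat k \<le> d}"

definition property_D :: "enat \<Rightarrow> int \<Rightarrow> nat set \<Rightarrow> bool" where
  "property_D d n A \<longleftrightarrow>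
     (\<forall>a\<in>A. \<forall>b\<in>A. a \<noteq> b \<longrightarrow> int a * int b + n \<in> int ` V d)"

definition ecard :: "'a set \<Rightarrow> enat" where
  "ecard A = (if finite A then enat (card A) else \<infinity>)"

definition M :: "enat \<Rightarrow> int \<Rightarrow> enat" where
  "M d n = (SUP A\<in>{A. A \<subseteq> {1..} \<and> property_D d n A}. ecard A)"

definition f_tilde :: "real \<Rightarrow> nat" where
  "f_tilde x =
     Max {card A | A n. A \<subseteq> {a. 1 \<le> a \<and> real a \<le> x} \<and>
                        1 \<le> \<bar>n\<bar> \<and> real_of_int \<bar>n\<bar> \<le> x \<and> property_D \<infinity> n A}"

end

theory Submission
  imports Defs "HOL-Computational_Algebra.Computational_Algebra" "HOL-Computational_Algebra.Field_as_Ring"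
begin

text \<open>
  Colour the edge \<open>{a, b}\<close> of the complete graph on \<open>A\<close> by a prime \<open>p \<le> d\<close> such that \<open>a b + n\<close> is a
  \<open>p\<close>-th power. For \<open>p \<ge> 25\<close>, many common neighbours \<open>b\<^sub>i\<close> of two vertices \<open>a\<close>, \<open>a'\<close> would give,
  with \<open>x\<^sub>i\<^sup>p = a b\<^sub>i + n\<close> and \<open>y\<^sub>i\<^sup>p = a' b\<^sub>i + n\<close>, a solution of the Lander--Parkin--Selfridge equation
  in products \<open>x\<^sub>i y\<^sub>j\<close>. For \<open>p < 25\<close>, the common neighbours \<open>b\<close> of seven vertices give rational points
  on a smooth plane curve of genus \<open>(2 p - 1) (p - 1)\<close>: three products
  \<open>(n + x\<^sub>i b) (n + y\<^sub>i b)\<close> are the coordinates of a point on a conic independent of \<open>b\<close>, and the curve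
  is the preimage of that conic under \<open>[X : Y : Z] \<mapsto> [X\<^sup>p : Y\<^sup>p : Z\<^sup>p]\<close>. So the colour classes
  contain no large \<open>K\<^bsub>2,t\<^esub>\<close> or \<open>K\<^bsub>7,t\<^esub>\<close>, which bounds \<open>|A|\<close> by a constant times the square of the
  number of primes up to \<open>d\<close>.
\<close>

section \<open>Counting primes\<close>

text \<open>The colours have to be treated in two ways. Excluding K(2,t) saves a factor of order
  sqrt m on m vertices in every colour, and this is what makes the bound quadratic in the number of
  colours; prime exponents give d / log d colours instead of d. For p < 25 only K(7,t) is excluded,
  a far weaker condition, but there are just nine such primes, so it is enough that each of them
  takes a small proportion of the pairs. For these p the curve must have genus at least 2, and the
  genus must not depend on n or on the vertices, so that one constant serves all tuples. Three
  linear forms n + x b alone would give points on a line, whose preimage is a twisted Fermat curve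
  of genus (p - 1) (p - 2) / 2, useless for p = 2 and p = 3. Multiplying the forms in pairs turns
  the line into a conic, and the genus is at least 3 already for p = 2. Three pairs use six
  vertices; the seventh is a spare, exchanged for one of the six when the three quadratics happen to
  be linearly dependent and the conic degenerates.\<close>

lemma central_binomial_odd_le: "(2 * m + 1) choose m \<le> (4::nat) ^ m"
proof -
  \<comment> \<open>The two central coefficients of an odd row are equal, so each is at most half of
    the row sum 2 * 4^m.\<close>
  have "(2 * m + 1 choose m) + (2 * m + 1 choose (m + 1)) = (\<Sum>k\<in>{m, m + 1}. 2 * m + 1 choose k)"
    by simp
  also have "\<dots> \<le> (\<Sum>k\<le>2 * m + 1. 2 * m + 1 choose k)"
    by (intro sum_mono2) auto
  also have "\<dots> = 2 * 4 ^ m"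
    by (simp only: choose_row_sum) (simp add: power_mult)
  finally show ?thesis
    using binomial_symmetric[of m "2 * m + 1"] by simp
qed

lemma prod_primes_dvd:
  fixes n :: nat
  assumes "finite P" "\<And>p. p \<in> P \<Longrightarrow> prime p" "\<And>p. p \<in> P \<Longrightarrow> p dvd n"
  shows "\<Prod>P dvd n"
  using assms
proof (induction P rule: finite_induct)
  case (insert p P)
  have "coprime p (\<Prod>P)"
    using insert by (intro prod_coprime_right primes_coprime) auto
  with insert show ?case
    by (simp add: divides_mult)
qed simp

text \<open>Erdos's induction. For n = 2 m + 1 the primes in (m + 1, n] divide (2 m + 1)! but
  neither m! nor (m + 1)!, hence they divide a central binomial coefficient; the smaller primes are
  covered by the bound for m + 1. An even n > 2 is not prime, so the bound for n - 1
  applies.\<close>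

lemma primorial_le: "\<Prod>{p::nat. prime p \<and> p \<le> n} \<le> 4 ^ n"
proof (induction n rule: less_induct)
  case (less n)
  have fin: "finite {p::nat. prime p \<and> p \<le> k}" for k
    by (rule finite_subset[of _ "{..k}"]) auto
  consider "n < 2" | "n = 2" | m where "n = 2 * m" "m \<ge> 2" | m where "n = 2 * m + 1" "m \<ge> 1"
  proof -
    have "n < 2 \<or> n = 2 \<or> (\<exists>m. n = 2 * m \<and> m \<ge> 2) \<or> (\<exists>m. n = 2 * m + 1 \<and> m \<ge> 1)"
      by presburger
    then show ?thesis
      using that by blast
  qed
  then show ?case
  proof cases
    case 1
    then have "\<not> (prime p \<and> p \<le> n)" for p
      using prime_ge_2_nat[of p] by linarith
    then show ?thesis by (simp only: simp_thms Collect_empty_eq prod.empty) simp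
  next
    case 2
    then have "prime p \<and> p \<le> n \<longleftrightarrow> p = 2" for p
      using prime_ge_2_nat[of p] by auto
    then show ?thesis using 2 by simp
  next
    case (3 m)
    have "\<not> prime n"
      using 3 prime_product[of 2 m] by auto
    then have "prime p \<and> p \<le> n \<longleftrightarrow> prime p \<and> p \<le> n - 1" for p
      using 3 by (cases "p = n") auto
    then have "\<Prod>{p::nat. prime p \<and> p \<le> n} = \<Prod>{p. prime p \<and> p \<le> n - 1}"
      by simp
    also have "\<dots> \<le> 4 ^ (n - 1)"
      using 3 by (intro less) auto
    also have "\<dots> \<le> 4 ^ n"
      by (intro power_increasing) auto
    finally show ?thesis .
  next
    case (4 m)
    define P where "P = {p. prime p \<and> m + 1 < p \<and> p \<le> n}"
    have finP: "finite P"
      unfolding P_def by (rule finite_subset[OF _ fin[of n]]) auto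
    have "\<Prod>P dvd (2 * m + 1 choose m)"
    proof (rule prod_primes_dvd[OF finP])
      show "prime p" if "p \<in> P" for p
        using that by (simp add: P_def)
      fix p assume p: "p \<in> P"
      have "fact (2 * m + 1) = fact m * fact (m + 1) * (2 * m + 1 choose m)"
        using binomial_fact_lemma[of m "2 * m + 1"] by simp
      moreover have "p dvd fact (2 * m + 1)"
        using p 4 by (auto simp: P_def prime_dvd_fact_iff simp del: fact_Suc)
      moreover have "\<not> p dvd fact m" "\<not> p dvd fact (m + 1)"
        using p by (auto simp: P_def prime_dvd_fact_iff simp del: fact_Suc)
      ultimately show "p dvd (2 * m + 1 choose m)"
        using p by (auto simp: P_def prime_dvd_mult_iff)
    qed
    then have "\<Prod>P \<le> (2 * m + 1 choose m)"
      by (intro dvd_imp_le) (auto simp: zero_less_binomial_iff)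
    then have P: "\<Prod>P \<le> 4 ^ m"
      using central_binomial_odd_le le_trans by blast
    have "{p. prime p \<and> p \<le> n} = {p. prime p \<and> p \<le> m + 1} \<union> P"
      using 4 by (auto simp: P_def)
    then have "\<Prod>{p. prime p \<and> p \<le> n} = \<Prod>{p. prime p \<and> p \<le> m + 1} * \<Prod>P"
      using finP fin[of "m + 1"] by (auto simp: P_def intro!: prod.union_disjoint)
    also have "\<dots> \<le> 4 ^ (m + 1) * 4 ^ m"
      using 4 by (intro mult_mono P less) auto
    also have "\<dots> = 4 ^ n"
      using 4 by (simp flip: power_add add: mult_2)
    finally show ?thesis .
  qed
qed

text \<open>Chebyshev's upper bound, split at sqrt d. At most sqrt d \<le> 2 d / ln d primes lie
  below. Those above satisfy d < p^2, so d to the power \<open>card L\<close> is at most the square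
  of the primorial, that is at most 16^d, and ln 16 \<le> 4. Together this gives 6 = 2 + 4.\<close>

lemma prime_count_le:
  fixes d :: nat
  assumes "d \<ge> 2"
  shows "real (card {p. prime p \<and> p \<le> d}) \<le> 6 * (d / ln d)"
proof -
  define S where "S = {p. prime p \<and> p \<le> d \<and> p\<^sup>2 \<le> d}"
  define L where "L = {p. prime p \<and> p \<le> d \<and> d < p\<^sup>2}"
  have fin: "finite {p. prime p \<and> p \<le> d}"
    by (rule finite_subset[of _ "{..d}"]) auto
  have finS: "finite S" and finL: "finite L"
    unfolding S_def L_def by (auto intro: finite_subset[OF _ fin])
  have ln0: "ln (real d) > 0"
    using assms by simp
  have "S \<subseteq> {1..nat \<lfloor>sqrt d\<rfloor>}"
  proof
    fix p assume p: "p \<in> S"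
    then have "(real p)\<^sup>2 \<le> d"
      unfolding S_def mem_Collect_eq of_nat_power[symmetric] of_nat_le_iff by blast
    then have "real p \<le> sqrt d"
      by (simp add: real_le_rsqrt)
    then show "p \<in> {1..nat \<lfloor>sqrt d\<rfloor>}"
      using p prime_ge_1_nat by (auto simp: S_def le_nat_floor)
  qed
  then have "card S \<le> nat \<lfloor>sqrt d\<rfloor>"
    by (metis card_atLeastAtMost card_mono diff_Suc_1 finite_atLeastAtMost)
  then have "real (card S) \<le> sqrt d"
    by (metis of_nat_floor of_nat_mono order_trans real_sqrt_ge_0_iff of_nat_0_le_iff)
  also have "sqrt d \<le> 2 * (d / ln d)"
  proof -
    have "ln (real d) = 2 * ln (sqrt d)"
      using assms by (simp add: ln_sqrt)
    also have "ln (sqrt d) \<le> sqrt d"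
      using ln_le_minus_one[of "sqrt d"] assms by simp
    finally have "sqrt d * ln d \<le> sqrt d * (2 * sqrt d)"
      by (intro mult_left_mono) auto
    also have "\<dots> = 2 * d"
      by simp
    finally show ?thesis
      using ln0 by (simp add: field_simps)
  qed
  finally have S: "real (card S) \<le> 2 * (d / ln d)" .
  have "d ^ card L = (\<Prod>p\<in>L. d)"
    by simp
  also have "\<dots> \<le> (\<Prod>p\<in>L. p\<^sup>2)"
    by (intro prod_mono) (auto simp: L_def)
  also have "\<dots> = (\<Prod>L)\<^sup>2"
    by (simp add: prod_power_distrib)
  finally have *: "d ^ card L \<le> (\<Prod>L)\<^sup>2" .
  have "\<Prod>L \<le> \<Prod>{p. prime p \<and> p \<le> d}"
    by (intro dvd_imp_le prod_dvd_prod_subset[OF fin] prod_pos) (auto simp: L_def prime_gt_0_nat)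
  also have "\<dots> \<le> 4 ^ d"
    by (rule primorial_le)
  finally have "(\<Prod>L)\<^sup>2 \<le> (4 ^ d)\<^sup>2"
    by (rule power_mono) simp
  with * have "d ^ card L \<le> (4 ^ d)\<^sup>2"
    by (rule le_trans)
  then have "real d ^ card L \<le> (4 ^ d)\<^sup>2"
    by (metis of_nat_le_iff of_nat_power of_nat_numeral)
  then have "ln (real d ^ card L) \<le> ln ((4 ^ d)\<^sup>2)"
    using assms by (intro ln_mono) auto
  also have "\<dots> = 4 * ln 2 * d"
    using ln_realpow[of 2 2] by (simp add: ln_realpow power2_eq_square ln_mult)
  also have "\<dots> \<le> 4 * (1 :: real) * d"
    using ln_le_minus_one[of "2 :: real"] by (intro mult_right_mono) auto
  finally have "card L * ln d \<le> 4 * d"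
    using assms by (simp add: ln_realpow)
  then have L: "real (card L) \<le> 4 * (d / ln d)"
    using ln0 by (simp add: field_simps)
  have "{p. prime p \<and> p \<le> d} = S \<union> L"
    by (auto simp: S_def L_def)
  then have "card {p. prime p \<and> p \<le> d} \<le> card S + card L"
    using card_Un_le by metis
  then show ?thesis
    using S L by linarith
qed

section \<open>Edge colourings without large complete bipartite graphs\<close>

text \<open>Double counting of the pairs (v, S) where S is a k-set of neighbours of v, as in the
  theorem of Kovari, Sos and Turan.\<close>

lemma sum_neighbours_choose_le:
  assumes "finite A"
    and common: "\<And>S. S \<subseteq> A \<Longrightarrow> card S = k \<Longrightarrow> card {v\<in>A. \<forall>s\<in>S. E s v} \<le> t"
  shows "(\<Sum>v\<in>A. card {s\<in>A. E s v} choose k) \<le> t * (card A choose k)"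
proof -
  define K where "K = {S. S \<subseteq> A \<and> card S = k}"
  have finK: "finite K"
    unfolding K_def using assms(1) by simp
  have "(\<Sum>v\<in>A. card {s\<in>A. E s v} choose k) = (\<Sum>v\<in>A. \<Sum>S\<in>K. if \<forall>s\<in>S. E s v then 1 else 0)"
  proof (rule sum.cong[OF refl])
    fix v
    have "card {s\<in>A. E s v} choose k = card {S. S \<subseteq> {s\<in>A. E s v} \<and> card S = k}"
      using assms(1) by (simp add: n_subsets)
    also have "{S. S \<subseteq> {s\<in>A. E s v} \<and> card S = k} = {S\<in>K. \<forall>s\<in>S. E s v}"
      by (auto simp: K_def)
    also have "card \<dots> = (\<Sum>S\<in>K. if \<forall>s\<in>S. E s v then 1 else 0)"
      using finK by (simp flip: sum.inter_filter)
    finally show "card {s\<in>A. E s v} choose k = (\<Sum>S\<in>K. if \<forall>s\<in>S. E s v then 1 else 0)" .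
  qed
  also have "\<dots> = (\<Sum>S\<in>K. \<Sum>v\<in>A. if \<forall>s\<in>S. E s v then 1 else 0)"
    by (rule sum.swap)
  also have "\<dots> = (\<Sum>S\<in>K. card {v\<in>A. \<forall>s\<in>S. E s v})"
    using assms(1) by (simp flip: sum.inter_filter)
  also have "\<dots> \<le> (\<Sum>S\<in>K. t)"
    by (intro sum_mono common) (auto simp: K_def)
  also have "\<dots> = t * (card A choose k)"
    using assms(1) by (simp add: K_def n_subsets)
  finally show ?thesis .
qed

text \<open>Vertices of degree at least q, about m / 20, are bounded in number: each accounts for at
  least (q / 7)^7 of the at most t (21 q)^7 pairs counted above, and the quotient is t * 147^7 with
  147 = 7 * 21. Such a vertex has at most m neighbours, any other one fewer than m / 20.\<close>

lemma sum_neighbours_le_heavy: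
  assumes "finite A" "card A = m" "m \<ge> 420"
    and common: "\<And>S. S \<subseteq> A \<Longrightarrow> card S = 7 \<Longrightarrow> card {v\<in>A. \<forall>s\<in>S. E s v} \<le> t"
  shows "(\<Sum>v\<in>A. real (card {s\<in>A. E s v})) \<le> m * (real t * 147 ^ 7) + m * (m / 20)"
proof -
  \<comment> \<open>From m \<ge> 420 one gets q \<ge> 21, so m \<le> 20 q + 19 \<le> 21 q; rounding
    down costs only the step from 20 to 21.\<close>
  define q where "q = m div 20"
  have q: "q \<ge> 21" "m \<le> 21 * q" "real q \<le> m / 20"
    using assms(3) unfolding q_def by linarith+
  define H where "H = {v\<in>A. q \<le> card {s\<in>A. E s v}}"
  have finH: "finite H" "H \<subseteq> A"
    using assms(1) by (auto simp: H_def)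
  have "card H * (q choose 7) = (\<Sum>v\<in>H. q choose 7)"
    by simp
  also have "\<dots> \<le> (\<Sum>v\<in>H. card {s\<in>A. E s v} choose 7)"
    by (intro sum_mono binomial_right_mono) (auto simp: H_def)
  also have "\<dots> \<le> (\<Sum>v\<in>A. card {s\<in>A. E s v} choose 7)"
    using finH assms(1) by (intro sum_mono2) auto
  also have "\<dots> \<le> t * (m choose 7)"
    using sum_neighbours_choose_le[OF assms(1) common] assms(2) by simp
  also have "\<dots> \<le> t * m ^ 7"
    using q by (intro mult_left_mono binomial_le_pow) auto
  also have "\<dots> \<le> t * (21 * q) ^ 7"
    using q by (intro mult_left_mono power_mono) auto
  finally have "card H * (q choose 7) \<le> t * (21 * q) ^ 7" .
  then have "real (card H) * real (q choose 7) \<le> real t * (21 * real q) ^ 7"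
    by (metis (mono_tags) of_nat_le_iff of_nat_mult of_nat_numeral of_nat_power)
  moreover have "(real q / 7) ^ 7 \<le> real (q choose 7)"
    using binomial_ge_n_over_k_pow_k[of 7 q, where 'a = real] q by simp
  ultimately have "real (card H) * (real q / 7) ^ 7 \<le> real t * (21 * real q) ^ 7"
    by (meson mult_left_mono of_nat_0_le_iff order_trans)
  also have "\<dots> = (real t * 147 ^ 7) * (real q / 7) ^ 7"
    by (simp add: field_simps)
  finally have H: "real (card H) \<le> real t * 147 ^ 7"
    using q by simp
  have "(\<Sum>v\<in>A. real (card {s\<in>A. E s v})) =
      (\<Sum>v\<in>H. real (card {s\<in>A. E s v})) + (\<Sum>v\<in>A - H. real (card {s\<in>A. E s v}))"
    using sum.subset_diff[OF finH(2) assms(1)] by (simp add: add.commute)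
  also have "\<dots> \<le> (\<Sum>v\<in>H. real m) + (\<Sum>v\<in>A - H. real q)"
  proof (intro add_mono sum_mono)
    show "real (card {s\<in>A. E s v}) \<le> real m" for v
      using assms by (auto intro!: card_mono)
  qed (auto simp: H_def)
  also have "\<dots> \<le> real m * card H + m * real q"
    using assms(2) card_mono[OF assms(1), of "A - H"]
    by (auto intro!: mult_left_mono simp: mult.commute)
  also have "\<dots> \<le> m * (real t * 147 ^ 7) + m * (m / 20)"
    using H q by (intro add_mono mult_left_mono) auto
  finally show ?thesis .
qed

text \<open>A pointwise substitute for Cauchy-Schwarz: expanding (s - d)^2 \<ge> 0 with s = sqrt m
  gives (2 s - 1) d \<le> m + d (d - 1) for every degree d, and the sum of the d (d - 1) is bounded
  by double counting. Since s \<ge> 1, the factor 2 s - 1 is at least s.\<close>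

lemma sum_neighbours_le_sqrt:
  assumes "finite A" "card A = m" "m \<ge> 1"
    and common: "\<And>S. S \<subseteq> A \<Longrightarrow> card S = 2 \<Longrightarrow> card {v\<in>A. \<forall>s\<in>S. E s v} \<le> t"
  shows "(\<Sum>v\<in>A. real (card {s\<in>A. E s v})) \<le> (1 + real t) * (m * sqrt m)"
proof -
  define d where "d v = card {s\<in>A. E s v}" for v
  have choose2: "real n * (real n - 1) = 2 * real (n choose 2)" for n
  proof -
    have "2 * (n choose 2) = n * (n - 1)"
      by (simp add: choose_two algebra_simps)
    then have "real (2 * (n choose 2)) = real (n * (n - 1))"
      by (rule arg_cong)
    then show ?thesis
      by (cases n) (auto simp: algebra_simps)
  qed
  define s where "s = sqrt m"
  have s: "s \<ge> 1" "s\<^sup>2 = m"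
    using assms(3) by (auto simp: s_def)
  have "s * (\<Sum>v\<in>A. real (d v)) \<le> (2 * s - 1) * (\<Sum>v\<in>A. real (d v))"
    using s by (intro mult_right_mono sum_nonneg) auto
  also have "\<dots> = (\<Sum>v\<in>A. (2 * s - 1) * d v)"
    by (rule sum_distrib_left)
  also have "\<dots> \<le> (\<Sum>v\<in>A. m + 2 * real (d v choose 2))"
  proof (rule sum_mono)
    fix v
    have "0 \<le> (s - d v)\<^sup>2"
      by simp
    then show "(2 * s - 1) * d v \<le> m + 2 * real (d v choose 2)"
      unfolding choose2[symmetric] s(2)[symmetric] by (simp add: power2_eq_square algebra_simps)
  qed
  also have "\<dots> = real m * m + 2 * real (\<Sum>v\<in>A. d v choose 2)"
    using assms(2) by (simp add: sum.distrib sum_distrib_left)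
  also have "\<dots> \<le> real m * m + 2 * real (t * (m choose 2))"
    using sum_neighbours_choose_le[OF assms(1) common] assms(2) unfolding d_def of_nat_le_iff
    by (intro add_left_mono mult_left_mono) (auto simp del: of_nat_sum of_nat_mult)
  also have "\<dots> = real m * m + t * (real m * (real m - 1))"
    unfolding choose2 by simp
  also have "\<dots> \<le> real m * m + t * (real m * real m)"
    by (intro add_left_mono mult_left_mono) auto
  also have "\<dots> = s * ((1 + real t) * (m * s))"
    unfolding s(2)[symmetric] by (simp add: algebra_simps power2_eq_square)
  finally show ?thesis
    using s(1) by (simp add: s_def d_def)
qed

text \<open>The m (m - 1) ordered pairs are shared among the colours. With the proportion 1/20 the
  nine colours of \<open>P\<close> leave enough: for m > 20 (9 h + 1), division by m yields m / 2
  \<le> \<open>card Q\<close> * (1 + t) * sqrt m. Smaller m are absorbed by the additive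
  constant.\<close>

lemma edge_coloured_clique_card_le:
  fixes E :: "'c \<Rightarrow> 'a \<Rightarrow> 'a \<Rightarrow> bool"
  assumes "finite A" "finite P" "card P \<le> 9" "finite Q" "t \<ge> 1"
    and cover: "\<And>a b. a \<in> A \<Longrightarrow> b \<in> A \<Longrightarrow> a \<noteq> b \<Longrightarrow> \<exists>p\<in>P \<union> Q. E p a b"
    and common7: "\<And>p S. p \<in> P \<Longrightarrow> S \<subseteq> A \<Longrightarrow> card S = 7 \<Longrightarrow> card {v\<in>A. \<forall>s\<in>S. E p s v} \<le> t"
    and common2: "\<And>p S. p \<in> Q \<Longrightarrow> S \<subseteq> A \<Longrightarrow> card S = 2 \<Longrightarrow> card {v\<in>A. \<forall>s\<in>S. E p s v} \<le> t"
  shows "real (card A) \<le> 20 * (9 * (real t * 147 ^ 7) + 1) + 4 * (1 + real t)\<^sup>2 * (real (card Q))\<^sup>2"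
proof (cases "real (card A) \<le> 20 * (9 * (real t * 147 ^ 7) + 1)")
  case True
  then show ?thesis
    by (rule order_trans) simp
next
  case False
  define m where "m = card A"
  define h where "h = real t * 147 ^ 7"
  have h: "h \<ge> 147 ^ 7"
    using assms(5) by (simp add: h_def)
  have m: "real m > 20 * (9 * h + 1)" "real m \<ge> 420"
    using False h by (auto simp: m_def h_def)
  define e where "e p = (\<Sum>v\<in>A. real (card {s\<in>A. E p s v}))" for p
  have "real m * (m - 1) = (\<Sum>v\<in>A. real (card (A - {v})))"
    using assms(1) by (simp add: m_def)
  also have "\<dots> \<le> (\<Sum>v\<in>A. \<Sum>p\<in>P \<union> Q. real (card {s\<in>A. E p s v}))"
  proof (rule sum_mono)
    fix v assume "v \<in> A"
    have "A - {v} \<subseteq> (\<Union>p\<in>P \<union> Q. {s\<in>A. E p s v})"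
    proof
      fix s assume "s \<in> A - {v}"
      with \<open>v \<in> A\<close> show "s \<in> (\<Union>p\<in>P \<union> Q. {s\<in>A. E p s v})"
        using cover[of s v] by auto
    qed
    then have "card (A - {v}) \<le> card (\<Union>p\<in>P \<union> Q. {s\<in>A. E p s v})"
      using assms(1,2,4) by (intro card_mono finite_UN_I finite_UnI) simp_all
    also have "\<dots> \<le> (\<Sum>p\<in>P \<union> Q. card {s\<in>A. E p s v})"
      using assms(2,4) by (intro card_UN_le finite_UnI)
    finally show "real (card (A - {v})) \<le> (\<Sum>p\<in>P \<union> Q. real (card {s\<in>A. E p s v}))"
      unfolding of_nat_sum[symmetric] of_nat_le_iff .
  qed
  also have "\<dots> = (\<Sum>p\<in>P \<union> Q. e p)"
    unfolding e_def by (rule sum.swap)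
  also have "\<dots> \<le> (\<Sum>p\<in>P. e p) + (\<Sum>p\<in>Q. e p)"
  proof -
    have "0 \<le> sum e (P \<inter> Q)"
      by (simp add: e_def sum_nonneg)
    then show ?thesis
      using sum.union_inter[OF assms(2,4), of e] by linarith
  qed
  also have "\<dots> \<le> (\<Sum>p\<in>P. m * h + m * (m / 20)) + (\<Sum>p\<in>Q. (1 + real t) * (m * sqrt m))"
  proof (intro add_mono sum_mono)
    show "e p \<le> m * h + m * (m / 20)" if "p \<in> P" for p
      unfolding e_def h_def using m common7[OF that]
      by (intro sum_neighbours_le_heavy[OF assms(1)]) (simp_all add: m_def)
    show "e p \<le> (1 + real t) * (m * sqrt m)" if "p \<in> Q" for p
      unfolding e_def using m common2[OF that]
      by (intro sum_neighbours_le_sqrt[OF assms(1)]) (simp_all add: m_def)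
  qed
  also have "\<dots> = card P * (m * h + m * (m / 20)) + card Q * ((1 + real t) * (m * sqrt m))"
    by simp
  also have "\<dots> \<le> 9 * (m * h + m * (m / 20)) + card Q * ((1 + real t) * (m * sqrt m))"
    using assms(3) h by (intro add_right_mono mult_right_mono) auto
  also have "\<dots> = real m * (9 * h + 9 * real m / 20 + card Q * (1 + real t) * sqrt m)"
    by (simp add: algebra_simps)
  finally have "real (m - 1) \<le> 9 * h + 9 * real m / 20 + card Q * (1 + real t) * sqrt m"
    by (rule mult_left_le_imp_le) (use m in simp)
  moreover have "real (m - 1) = real m - 1"
    using m(2) by (cases m) auto
  moreover have "9 * h + 1 < real m / 20"
    using m(1) by simp
  ultimately have "real m \<le> 2 * (card Q * (1 + real t) * sqrt m)"
    by argo
  then have "sqrt m * sqrt m \<le> (2 * card Q * (1 + real t)) * sqrt m"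
    by simp
  then have "sqrt m \<le> 2 * card Q * (1 + real t)"
    by (rule mult_right_le_imp_le) (use m in simp)
  then have "(sqrt m)\<^sup>2 \<le> (2 * card Q * (1 + real t))\<^sup>2"
    by (intro power_mono) auto
  also have "\<dots> = 4 * (1 + real t)\<^sup>2 * (real (card Q))\<^sup>2"
    by (simp add: power2_eq_square)
  finally have "real (card A) \<le> 4 * (1 + real t)\<^sup>2 * (real (card Q))\<^sup>2"
    unfolding m_def by simp
  then show ?thesis
    by (rule order_trans) simp
qed

section \<open>Large exponents\<close>

text \<open>Only products with i \<noteq> j will be used, and (i, j) and (j, i) must give different
  values: they end up on opposite sides of the equation.\<close>

definition distinct_cross_products :: "('a \<Rightarrow> nat) \<Rightarrow> ('a \<Rightarrow> nat) \<Rightarrow> 'a set \<Rightarrow> bool" where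
  "distinct_cross_products x y S \<longleftrightarrow>
     (\<forall>i\<in>S. \<forall>j\<in>S. \<forall>k\<in>S. \<forall>l\<in>S. i \<noteq> j \<longrightarrow> k \<noteq> l \<longrightarrow> x i * y j = x k * y l \<longrightarrow> i = k \<and> j = l)"

text \<open>A union bound for the greedy choice below: each forbidden equation, indexed by
  \<open>T\<close>, rules out at most one element of \<open>B\<close>.\<close>

lemma card_solutions_le:
  assumes "finite T" "\<And>t b c. t \<in> T \<Longrightarrow> b \<in> B \<Longrightarrow> c \<in> B \<Longrightarrow> R t b \<Longrightarrow> R t c \<Longrightarrow> b = c"
  shows "finite {b\<in>B. \<exists>t\<in>T. R t b}" "card {b\<in>B. \<exists>t\<in>T. R t b} \<le> card T"
proof -
  have eq: "{b\<in>B. \<exists>t\<in>T. R t b} = (\<Union>t\<in>T. {b\<in>B. R t b})"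
    by auto
  have one: "finite {b\<in>B. R t b} \<and> card {b\<in>B. R t b} \<le> 1" if "t \<in> T" for t
  proof (cases "{b\<in>B. R t b} = {}")
    case False
    then obtain b where "b \<in> B" "R t b"
      by auto
    then have "{b\<in>B. R t b} = {b}"
      using assms(2)[OF that] by auto
    then show ?thesis by simp
  next
    case True
    then show ?thesis by (simp only: True) simp
  qed
  show "finite {b\<in>B. \<exists>t\<in>T. R t b}"
    unfolding eq using one assms(1) by simp
  have "card (\<Union>t\<in>T. {b\<in>B. R t b}) \<le> (\<Sum>t\<in>T. card {b\<in>B. R t b})"
    by (rule card_UN_le[OF assms(1)])
  also have "\<dots> \<le> (\<Sum>t\<in>T. 1)"
    using one by (intro sum_mono) simp
  finally show "card {b\<in>B. \<exists>t\<in>T. R t b} \<le> card T"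
    unfolding eq by simp
qed

text \<open>A new element b can only fail by lying in S or by solving one of m^3 equations in x b,
  m^3 equations in y b, or m^2 equations x b * y i = x j * y b. Injectivity of x and y leaves one
  solution for each equation of the first two kinds; for the third kind, a solution has the
  prescribed ratio x b / y b, which determines b.\<close>

lemma distinct_cross_products_extend:
  fixes x y :: "'a \<Rightarrow> nat"
  assumes pos: "\<And>b. b \<in> B \<Longrightarrow> x b > 0" "\<And>b. b \<in> B \<Longrightarrow> y b > 0"
    and inj: "inj_on x B" "inj_on y B"
    and ratio: "\<And>b c. b \<in> B \<Longrightarrow> c \<in> B \<Longrightarrow> x b * y c = x c * y b \<Longrightarrow> b = c"
    and S: "finite S" "S \<subseteq> B" "distinct_cross_products x y S" "card S = m"
    and B: "finite B" "card B > 2 * m ^ 3 + m\<^sup>2 + m"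
  shows "\<exists>b\<in>B - S. distinct_cross_products x y (insert b S)"
proof -
  define T3 where "T3 = S \<times> S \<times> S"
  define T2 where "T2 = S \<times> S"
  have fin: "finite T3" "finite T2" and card: "card T3 = m ^ 3" "card T2 = m\<^sup>2"
    using S by (simp_all add: T2_def T3_def power2_eq_square power3_eq_cube card_cartesian_product)
  define B1 where "B1 = {b\<in>B. \<exists>t\<in>T3. case t of (i, j, l) \<Rightarrow> x b * y i = x j * y l}"
  define B2 where "B2 = {b\<in>B. \<exists>t\<in>T3. case t of (i, j, l) \<Rightarrow> x i * y b = x j * y l}"
  define B3 where "B3 = {b\<in>B. \<exists>t\<in>T2. case t of (i, j) \<Rightarrow> x b * y i = x j * y b}"
  have posS: "x s > 0" "y s > 0" if "s \<in> S" for s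
    using that pos S(2) by auto
  have inj1: "b = c" if "i \<in> S" "b \<in> B" "c \<in> B" "x b * y i = x j * y l" "x c * y i = x j * y l" for i j l b c
  proof -
    have "x b * y i = x c * y i"
      using that(4,5) by simp
    then show ?thesis
      using posS(2)[OF that(1)] inj_onD[OF inj(1) _ that(2,3)] by simp
  qed
  have inj2: "b = c" if "i \<in> S" "b \<in> B" "c \<in> B" "x i * y b = x j * y l" "x i * y c = x j * y l" for i j l b c
  proof -
    have "x i * y b = x i * y c"
      using that(4,5) by simp
    then show ?thesis
      using posS(1)[OF that(1)] inj_onD[OF inj(2) _ that(2,3)] by simp
  qed
  have B1: "finite B1" "card B1 \<le> m ^ 3"
    unfolding B1_def card(1)[symmetric]
    by (rule card_solutions_le[OF fin(1)]; auto simp: T3_def intro: inj1)+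
  have B2: "finite B2" "card B2 \<le> m ^ 3"
    unfolding B2_def card(1)[symmetric]
    by (rule card_solutions_le[OF fin(1)]; auto simp: T3_def intro: inj2)+
  have ratio': "b = c" if "i \<in> S" "j \<in> S" "b \<in> B" "c \<in> B" "x b * y i = x j * y b" "x c * y i = x j * y c" for i j b c
  proof (rule ratio[OF that(3,4)])
    have "(x b * y c) * (y i * x j) = (x b * y i) * (x j * y c)"
      by simp
    also have "\<dots> = (x j * y b) * (x c * y i)"
      using that(5,6) by simp
    also have "\<dots> = (x c * y b) * (y i * x j)"
      by simp
    finally show "x b * y c = x c * y b"
      using posS[of i] posS[of j] that(1,2) by simp
  qed
  have B3: "finite B3" "card B3 \<le> m\<^sup>2"
    unfolding B3_def card(2)[symmetric]
    by (rule card_solutions_le[OF fin(2)]; auto simp: T2_def intro: ratio')+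
  have "card (B1 \<union> B2 \<union> B3 \<union> S) \<le> card B1 + card B2 + card B3 + card S"
    by (meson add_le_mono1 card_Un_le order_trans)
  also have "\<dots> \<le> m ^ 3 + m ^ 3 + m\<^sup>2 + m"
    by (intro add_mono B1 B2 B3) (simp add: S)
  also have "\<dots> < card B"
    using B(2) by simp
  finally have "\<not> B \<subseteq> B1 \<union> B2 \<union> B3 \<union> S"
    using card_mono[of "B1 \<union> B2 \<union> B3 \<union> S" B] B1 B2 B3 S(1) by auto
  then obtain b where b: "b \<in> B" "b \<notin> S" "b \<notin> B1" "b \<notin> B2" "b \<notin> B3"
    by auto
  have n1: "x b * y i \<noteq> x j * y l" if "i \<in> S" "j \<in> S" "l \<in> S" for i j l
    using b(1,3) that unfolding B1_def T3_def by auto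
  have n2: "x i * y b \<noteq> x j * y l" if "i \<in> S" "j \<in> S" "l \<in> S" for i j l
    using b(1,4) that unfolding B2_def T3_def by auto
  have n3: "x b * y i \<noteq> x j * y b" if "i \<in> S" "j \<in> S" for i j
    using b(1,5) that unfolding B3_def T2_def by auto
  have "distinct_cross_products x y (insert b S)"
    unfolding distinct_cross_products_def
  proof (intro ballI impI)
    fix i j k l
    assume mem: "i \<in> insert b S" "j \<in> insert b S" "k \<in> insert b S" "l \<in> insert b S"
      and neq: "i \<noteq> j" "k \<noteq> l" and eq: "x i * y j = x k * y l"
    have bp: "x b > 0" "y b > 0"
      using pos b by auto
    have injS: "u = v" if "u \<in> S" "v \<in> S" "x u = x v \<or> y u = y v" for u v
      using that inj S(2) by (meson inj_onD subsetD)
    show "i = k \<and> j = l"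
    proof (cases "i = b"; cases "j = b"; cases "k = b"; cases "l = b")
      assume "i \<noteq> b" "j \<noteq> b" "k \<noteq> b" "l \<noteq> b"
      then show "i = k \<and> j = l"
        using mem neq eq S(3) unfolding distinct_cross_products_def by blast
    next
      assume "i = b" "j \<noteq> b" "k = b" "l \<noteq> b"
      then show "i = k \<and> j = l"
        using mem eq bp injS[of j l] by simp
    next
      assume "i \<noteq> b" "j = b" "k \<noteq> b" "l = b"
      then show "i = k \<and> j = l"
        using mem eq bp injS[of i k] by simp
    qed (use mem neq eq n1[of j k l] n1[of l i j] n2[of i k l] n2[of k i j] n3[of j k] n3[of l i] in simp_all)
  qed
  then show ?thesis
    using b by blast
qed

lemma distinct_cross_products_subset_exists:
  fixes x y :: "'a \<Rightarrow> nat"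
  assumes "\<And>b. b \<in> B \<Longrightarrow> x b > 0" "\<And>b. b \<in> B \<Longrightarrow> y b > 0"
    and "inj_on x B" "inj_on y B"
    and "\<And>b c. b \<in> B \<Longrightarrow> c \<in> B \<Longrightarrow> x b * y c = x c * y b \<Longrightarrow> b = c"
    and "finite B" "card B > 2 * m ^ 3 + m\<^sup>2 + m"
  shows "\<exists>S\<subseteq>B. finite S \<and> card S = Suc m \<and> distinct_cross_products x y S"
  using assms(7)
proof (induction m)
  case 0
  then obtain b where "b \<in> B"
    by fastforce
  then show ?case
    by (intro exI[of _ "{b}"]) (auto simp: distinct_cross_products_def)
next
  case (Suc m)
  have "2 * m ^ 3 + m\<^sup>2 + m < card B"
    using Suc.prems power_mono[of m "Suc m" 3] power_mono[of m "Suc m" 2] by linarith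
  then obtain S where S: "S \<subseteq> B" "finite S" "card S = Suc m" "distinct_cross_products x y S"
    using Suc.IH by auto
  obtain b where "b \<in> B - S" "distinct_cross_products x y (insert b S)"
    using distinct_cross_products_extend[OF assms(1-5) S(2,1,4,3) assms(6) Suc.prems] by blast
  then show ?case
    using S by (intro exI[of _ "insert b S"]) auto
qed

text \<open>
  Expanding, \<open>(x\<^sub>i y\<^sub>j)\<^sup>p - (x\<^sub>j y\<^sub>i)\<^sup>p = n (a - a') (b\<^sub>i - b\<^sub>j)\<close>, which telescopes to \<open>0\<close> along a cycle
  of length 12.
\<close>

lemma lander_parkin_selfridge_common_neighbours:
  assumes "lander_parkin_selfridge_special" "p \<ge> 25" "n \<noteq> 0" "a \<noteq> a'" "finite B"
    and xy: "\<And>b. b \<in> B \<Longrightarrow> \<exists>x\<ge>1. int a * int b + n = int (x ^ p)"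
      "\<And>b. b \<in> B \<Longrightarrow> \<exists>x\<ge>1. int a' * int b + n = int (x ^ p)"
    and "a > 0" "a' > 0"
  shows "card B \<le> 2794"
proof (rule ccontr)
  assume "\<not> card B \<le> 2794"
  \<comment> \<open>2794 = 2 * 11^3 + 11^2 + 11 is the number of elements beyond which the greedy
    choice extends eleven elements to twelve.\<close>
  then have card: "card B > 2 * 11 ^ 3 + 11\<^sup>2 + 11"
    by simp
  obtain x where x: "\<And>b. b \<in> B \<Longrightarrow> x b \<ge> 1 \<and> int a * int b + n = int (x b ^ p)"
    using xy(1) by metis
  obtain y where y: "\<And>b. b \<in> B \<Longrightarrow> y b \<ge> 1 \<and> int a' * int b + n = int (y b ^ p)"
    using xy(2) by metis
  have p: "p > 0"
    using assms(2) by simp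
  have cross: "int ((x b * y c) ^ p) - int ((x c * y b) ^ p) = n * (int a - int a') * (int b - int c)"
    if "b \<in> B" "c \<in> B" for b c
  proof -
    have "int ((x b * y c) ^ p) - int ((x c * y b) ^ p) =
        int (x b ^ p) * int (y c ^ p) - int (x c ^ p) * int (y b ^ p)"
      by (simp add: power_mult_distrib)
    also have "\<dots> = (int a * int b + n) * (int a' * int c + n) - (int a * int c + n) * (int a' * int b + n)"
      using x[OF that(1)] x[OF that(2)] y[OF that(1)] y[OF that(2)] by simp
    also have "\<dots> = n * (int a - int a') * (int b - int c)"
      by (simp add: algebra_simps)
    finally show ?thesis .
  qed
  have "inj_on x B"
  proof (rule inj_onI)
    fix b c assume "b \<in> B" "c \<in> B" "x b = x c"
    then have "int a * int b + n = int a * int c + n"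
      using x by metis
    then show "b = c"
      using assms(8) by simp
  qed
  moreover have "inj_on y B"
  proof (rule inj_onI)
    fix b c assume "b \<in> B" "c \<in> B" "y b = y c"
    then have "int a' * int b + n = int a' * int c + n"
      using y by metis
    then show "b = c"
      using assms(9) by simp
  qed
  moreover have "b = c" if "b \<in> B" "c \<in> B" "x b * y c = x c * y b" for b c
    using cross[OF that(1,2)] that(3) assms(3,4) by simp
  moreover have pos: "x b > 0" "y b > 0" if "b \<in> B" for b
    using x[OF that] y[OF that] by auto
  ultimately obtain S where S: "S \<subseteq> B" "finite S" "card S = Suc 11" "distinct_cross_products x y S"
    using distinct_cross_products_subset_exists[of B x y 11] assms(5) card by auto
  obtain e :: "nat \<Rightarrow> nat" where e: "bij_betw e {0..<12} S"
    using ex_bij_betw_nat_finite[OF S(2)] S(3) by auto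
  \<comment> \<open>Indices are read modulo 12, which closes the chain to a cycle; \<open>u\<close>
    runs through its edges in one direction, \<open>v\<close> in the other.\<close>
  define c where "c i = e (i mod 12)" for i :: nat
  have cS: "c i \<in> S" for i
    using bij_betwE[OF e] by (simp add: c_def)
  have c_eq: "c i = c j \<longleftrightarrow> i mod 12 = j mod 12" for i j
    by (simp add: c_def inj_on_eq_iff[OF bij_betw_imp_inj_on[OF e]])
  define u where "u i = x (c i) * y (c (Suc i))" for i
  define v where "v i = x (c (Suc i)) * y (c i)" for i
  have neq: "i mod 12 \<noteq> Suc i mod 12" for i :: nat
    by (simp add: mod_Suc)
  have mod12_inj: "i = j" if "i mod 12 = j mod 12" "i \<in> {1..12}" "j \<in> {1..12}" for i j :: nat
    using that by (cases "i = 12"; cases "j = 12") auto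
  have gen: "c i = c k \<and> c j = c l" if "x (c i) * y (c j) = x (c k) * y (c l)"
    "i mod 12 \<noteq> j mod 12" "k mod 12 \<noteq> l mod 12" for i j k l
    using S(4)[unfolded distinct_cross_products_def, rule_format, OF cS cS cS cS _ _ that(1)] that(2,3)
    unfolding c_eq by simp
  have "\<forall>i\<in>{1..12}. u i > 0 \<and> v i > 0"
    using pos[OF subsetD[OF S(1) cS]] by (simp add: u_def v_def)
  moreover have "inj_on u {1..12}"
  proof (rule inj_onI)
    fix i j :: nat assume "i \<in> {1..12}" "j \<in> {1..12}" "u i = u j"
    then show "i = j"
      using gen[of i "Suc i" j "Suc j"] neq[of i] neq[of j] mod12_inj[of i j] unfolding u_def c_eq by simp
  qed
  moreover have "inj_on v {1..12}"
  proof (rule inj_onI)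
    fix i j :: nat assume "i \<in> {1..12}" "j \<in> {1..12}" "v i = v j"
    then show "i = j"
      using gen[of "Suc i" i "Suc j" j] neq[of i] neq[of j] mod12_inj[of i j] unfolding v_def c_eq by simp
  qed
  \<comment> \<open>Equality would force i = j + 1 and i + 1 = j modulo 12, hence 2 = 0 modulo
    12.\<close>
  moreover have "u i \<noteq> v j" for i j
  proof
    assume "u i = v j"
    then show False
      using gen[of i "Suc i" "Suc j" j] neq[of i] neq[of j] unfolding u_def v_def c_eq
      by (simp add: mod_Suc split: if_splits)
  qed
  then have "u ` {1..12} \<inter> v ` {1..12} = {}"
    by auto
  moreover have "(\<Sum>i=1..12. u i ^ p) = (\<Sum>i=1..12. v i ^ p)"
  proof -
    have "int (\<Sum>i=1..12. u i ^ p) - int (\<Sum>i=1..12. v i ^ p) =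
        (\<Sum>i=1..12. int (u i ^ p) - int (v i ^ p))"
      by (simp add: sum_subtractf)
    also have "\<dots> = (\<Sum>i=1..12. n * (int a - int a') * (int (c i) - int (c (Suc i))))"
      unfolding u_def v_def using cross cS S(1) by (intro sum.cong refl) blast
    also have "\<dots> = - (n * (int a - int a')) * (\<Sum>i=1..12. int (c (Suc i)) - int (c i))"
      by (simp add: sum_distrib_left algebra_simps sum_subtractf sum.distrib)
    also have "(\<Sum>i=1..12. int (c (Suc i)) - int (c i)) = int (c (Suc 12)) - int (c 1)"
      by (rule sum_Suc_diff) simp
    also have "c (Suc 12) = c 1"
      unfolding c_eq by simp
    finally have "int (\<Sum>i=1..12. u i ^ p) = int (\<Sum>i=1..12. v i ^ p)"
      by simp
    then show ?thesis
      unfolding of_nat_eq_iff .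
  qed
  ultimately show False
    using assms(1)[unfolded lander_parkin_selfridge_special_def, rule_format, OF assms(2)] by blast
qed

section \<open>Irreducibility of conics in powers of the coordinates\<close>

lemma exists_root_of_unity_power_eq_1_iff:
  assumes "k \<ge> 1"
  shows "\<exists>\<zeta>::complex. \<forall>n. \<zeta> ^ n = 1 \<longleftrightarrow> k dvd n"
proof -
  define \<zeta> where "\<zeta> = exp (2 * of_real pi * \<i> / of_nat k)"
  have "\<zeta> ^ n = 1 \<longleftrightarrow> k dvd n" for n
    using complex_root_unity_eq_1[OF assms, of n]
    by (simp add: \<zeta>_def flip: exp_of_nat_mult) (simp add: mult_ac)
  then show ?thesis by blast
qed

lemma poly_root_exists:
  fixes p :: "complex poly"
  assumes "degree p > 0"
  shows "\<exists>z. poly p z = 0"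
proof -
  have "\<not> constant (poly p)"
    using assms by (simp add: constant_degree)
  then show ?thesis
    by (rule fundamental_theorem_of_algebra)
qed

lemma nth_root_exists:
  fixes w :: complex
  assumes "k > 0"
  shows "\<exists>z. z ^ k = w"
proof -
  have "coeff (monom 1 k - [:w:]) k = 1"
    using assms by (cases k) auto
  then have "k \<le> degree (monom 1 k - [:w:])"
    by (intro le_degree) simp
  then obtain z where "poly (monom 1 k - [:w:]) z = 0"
    using poly_root_exists[of "monom 1 k - [:w:]"] assms by auto
  then show ?thesis
    by (auto simp: poly_monom)
qed

text \<open>In terms of u = x^k this is a quadratic with nonzero discriminant, so its root u is
  simple, and u \<noteq> 0 because \<gamma> \<noteq> 0. Away from 0 the map from x to x^k is
  unramified, so simplicity is inherited by x.\<close>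

lemma simple_root_exists:
  fixes \<alpha> \<beta> \<gamma> :: complex
  assumes "k > 0" "\<alpha> \<noteq> 0" "\<gamma> \<noteq> 0" "\<beta>\<^sup>2 \<noteq> \<alpha> * \<gamma>"
  defines "P \<equiv> monom \<alpha> (2 * k) + monom (2 * \<beta>) k + [:\<gamma>:]"
  shows "\<exists>x. poly P x = 0 \<and> poly (pderiv P) x \<noteq> 0"
proof -
  define u where "u = (csqrt (\<beta>\<^sup>2 - \<alpha> * \<gamma>) - \<beta>) / \<alpha>"
  have sq: "(\<alpha> * u + \<beta>)\<^sup>2 = \<beta>\<^sup>2 - \<alpha> * \<gamma>"
    using assms(2) by (simp add: u_def)
  have "\<alpha> * (\<alpha> * u\<^sup>2 + 2 * \<beta> * u + \<gamma>) = (\<alpha> * u + \<beta>)\<^sup>2 - (\<beta>\<^sup>2 - \<alpha> * \<gamma>)"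
    by (simp add: power2_eq_square algebra_simps)
  then have root: "\<alpha> * u\<^sup>2 + 2 * \<beta> * u + \<gamma> = 0"
    using assms(2) sq by simp
  then have "u \<noteq> 0"
    using assms(3) by auto
  have der: "\<alpha> * u + \<beta> \<noteq> 0"
    using sq assms(4) by auto
  obtain x where x: "x ^ k = u"
    using nth_root_exists[OF assms(1)] by blast
  then have "x \<noteq> 0"
    using \<open>u \<noteq> 0\<close> assms(1) by auto
  have "poly P x = \<alpha> * u\<^sup>2 + 2 * \<beta> * u + \<gamma>"
    by (simp add: P_def poly_monom flip: x power_mult) (simp add: mult.commute)
  moreover have "x * poly (pderiv P) x = 2 * of_nat k * u * (\<alpha> * u + \<beta>)"
  proof -
    have "x * x ^ (2 * k - 1) = u\<^sup>2" "x * x ^ (k - 1) = u"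
      using assms(1) by (simp_all flip: x power_Suc power_mult add: mult.commute)
    moreover have "x * poly (pderiv P) x = of_nat (2 * k) * \<alpha> * (x * x ^ (2 * k - 1)) + of_nat k * (2 * \<beta>) * (x * x ^ (k - 1))"
      by (simp add: P_def pderiv_add pderiv_monom poly_monom pderiv_pCons algebra_simps)
    ultimately show ?thesis
      by (simp add: power2_eq_square algebra_simps)
  qed
  ultimately show ?thesis
    using root der \<open>u \<noteq> 0\<close> assms(1) by (intro exI[of _ x]) auto
qed

lemma square_root_not_simple:
  fixes r :: "complex poly"
  assumes "poly (r\<^sup>2) x = 0"
  shows "poly (pderiv (r\<^sup>2)) x = 0"
  using assms by (simp add: power2_eq_square pderiv_mult)

text \<open>The constant term is multiplicative, so divisibility by the prime \<open>q\<close>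
  passes to the constant term of some prime factor; that of a unit is a unit.\<close>

lemma prime_dvd_coeff_0_exists_factor:
  fixes f :: "complex poly poly"
  assumes "prime_elem q" "f \<noteq> 0" "q dvd coeff f 0"
  shows "\<exists>g. prime_elem g \<and> g dvd f \<and> q dvd coeff g 0"
  using assms(2,3)
proof (induction f rule: prime_divisors_induct)
  case (unit x)
  then obtain y where "1 = x * y"
    by (elim dvdE)
  then have "coeff (x * y) 0 = 1"
    by (metis lead_coeff_1 degree_1)
  then have "coeff x 0 dvd 1"
    by (metis coeff_mult_0 dvdI)
  then have "q dvd 1"
    using unit by (meson dvd_trans)
  then show ?case
    using assms(1) by (simp add: prime_elem_def)
next
  case (factor p x)
  then consider "q dvd coeff p 0" | "q dvd coeff x 0"
    using assms(1) by (auto simp: coeff_mult_0 prime_elem_dvd_mult_iff)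
  then show ?case
  proof cases
    case 1
    then show ?thesis
      using factor by (intro exI[of _ p]) auto
  next
    case 2
    then show ?thesis
      using factor by (metis dvd_mult mult_eq_0_iff)
  qed
qed simp

text \<open>
  Let \<open>\<zeta>\<close> be a primitive \<open>k\<close>-th root of unity and \<open>g\<close> a prime factor of \<open>f\<close> whose constant term
  vanishes at the simple root \<open>x\<^sub>0\<close> of \<open>C\<close>. If \<open>g\<close> did not divide \<open>g(\<zeta> y)\<close>, then \<open>g(y) g(\<zeta>\<^sup>-\<^sup>1 y)\<close>
  would divide \<open>f\<close>, and \<open>x\<^sub>0\<close> would be a double root of \<open>C\<close>. Hence \<open>g\<close> is a polynomial in \<open>y\<^sup>k\<close>; it
  cannot have degree \<open>k\<close>, because the discriminant of \<open>f\<close> as a polynomial in \<open>y\<^sup>k\<close> is not a square.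
\<close>

lemma prime_elem_quadratic_in_power:
  fixes B C :: "complex poly" and b :: complex
  assumes k: "k \<ge> 1" and b: "b \<noteq> 0"
    and C: "poly C x0 = 0" "poly (pderiv C) x0 \<noteq> 0"
    and D: "poly (B\<^sup>2 - smult (4 * b) C) x1 = 0" "poly (pderiv (B\<^sup>2 - smult (4 * b) C)) x1 \<noteq> 0"
  defines "f \<equiv> monom [:b:] (2 * k) + monom B k + [:C:]"
  shows "prime_elem f"
proof -
  define q where "q = [:- x0, 1:]"
  have coeff_f: "coeff f n = (if n = 2 * k then [:b:] else if n = k then B else if n = 0 then C else 0)" for n
    using k by (auto simp: f_def coeff_pCons split: nat.splits)
  have deg_f: "degree f = 2 * k"
  proof (rule antisym)
    show "degree f \<le> 2 * k"
      by (rule degree_le) (auto simp: coeff_f)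
    show "2 * k \<le> degree f"
      by (rule le_degree) (simp add: coeff_f b)
  qed
  have f0: "coeff f 0 = C"
    using k by (simp add: coeff_f)
  have lead_f: "lead_coeff f = [:b:]"
    by (simp add: deg_f coeff_f)
  have "f \<noteq> 0"
    using deg_f k by auto
  have "C \<noteq> 0"
    using C(2) by auto
  have q: "prime_elem q"
    unfolding q_def by (rule prime_elem_linear_field_poly) simp
  have "q dvd C"
    using C(1) by (simp add: q_def poly_eq_0_iff_dvd)
  have q2: "\<not> q * q dvd C"
  proof
    assume "q * q dvd C"
    then obtain h where "C = q * (q * h)"
      unfolding dvd_def mult.assoc by blast
    moreover have "poly q x0 = 0"
      by (simp add: q_def)
    ultimately show False
      using C(2) by (simp add: pderiv_mult)
  qed
  obtain g where g: "prime_elem g" "g dvd f" "q dvd coeff g 0"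
    using prime_dvd_coeff_0_exists_factor[OF q \<open>f \<noteq> 0\<close>] \<open>q dvd C\<close> f0 by auto
  obtain h where h: "f = g * h"
    using g(2) by (elim dvdE)
  have gh: "g \<noteq> 0" "h \<noteq> 0"
    using h \<open>f \<noteq> 0\<close> by auto
  have g0: "coeff g 0 \<noteq> 0"
    using f0 \<open>C \<noteq> 0\<close> by (auto simp: h coeff_mult_0)
  have "lead_coeff g * lead_coeff h = [:b:]"
    using lead_f by (simp add: h lead_coeff_mult)
  then have "is_unit (lead_coeff g * lead_coeff h)"
    using b by (simp add: is_unit_pCons_iff)
  then have unit: "is_unit (lead_coeff g)" "is_unit (lead_coeff h)"
    by (simp_all add: is_unit_mult_iff)
  obtain \<zeta> :: complex where \<zeta>: "\<And>n. \<zeta> ^ n = 1 \<longleftrightarrow> k dvd n"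
    using exists_root_of_unity_power_eq_1_iff[OF k] by blast
  have "\<zeta> \<noteq> 0"
    using \<zeta>[of k] k by (auto simp: power_0_left)
  \<comment> \<open>The substitution of z y for y. It fixes constant terms, and for z = \<zeta> it
    fixes \<open>f\<close>, where only the powers 0, k and 2 k of y occur.\<close>
  define sc where "sc z p = p \<circ>\<^sub>p [:0, [:z:]:]" for z :: complex and p :: "complex poly poly"
  have coeff_sc: "coeff (sc z p) n = smult (z ^ n) (coeff p n)" for z p n
    unfolding sc_def coeff_pcompose_linear by (simp flip: pCons_one add: poly_const_pow)
  have sc_inv: "sc (inverse \<zeta>) (sc \<zeta> p) = p" "sc \<zeta> (sc (inverse \<zeta>) p) = p" for p
    using \<open>\<zeta> \<noteq> 0\<close> by (auto simp: poly_eq_iff coeff_sc power_inverse)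
  have sc_mult: "sc z (u * v) = sc z u * sc z v" for z u v
    by (simp add: sc_def pcompose_mult)
  have sc_f: "sc \<zeta> f = f"
    using \<zeta>[of k] \<zeta>[of "2 * k"] by (auto simp: poly_eq_iff coeff_sc coeff_f)
  have "g dvd sc \<zeta> g"
  proof (rule ccontr)
    assume "\<not> g dvd sc \<zeta> g"
    moreover have "g dvd sc \<zeta> g * sc \<zeta> h"
      using g(2) sc_f by (simp add: h flip: sc_mult)
    ultimately have "g dvd sc \<zeta> h"
      using g(1) prime_elem_dvd_multD by blast
    then obtain m where "sc \<zeta> h = g * m"
      by (elim dvdE)
    then have "h = sc (inverse \<zeta>) g * sc (inverse \<zeta>) m"
      by (metis sc_inv(1) sc_mult)
    \<comment> \<open>Both \<open>g\<close> and its transform contribute the same constant term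
      \<open>coeff g 0\<close>, a multiple of \<open>q\<close>, so the square of \<open>q\<close>
      divides \<open>C\<close>.\<close>
    then have "C = coeff g 0 * (coeff g 0 * coeff (sc (inverse \<zeta>) m) 0)"
      using f0 by (simp add: h coeff_mult_0 coeff_sc)
    then show False
      using q2 g(3) by (metis dvd_triv_left mult.assoc mult_dvd_mono dvd_trans)
  qed
  then obtain m where m: "sc \<zeta> g = g * m"
    by (elim dvdE)
  have "degree (sc \<zeta> g) \<le> degree g"
    by (rule degree_le) (simp add: coeff_sc coeff_eq_0)
  moreover have "m \<noteq> 0"
    using m sc_inv(1)[of g] gh(1) by (metis coeff_0 mult_zero_right coeff_sc poly_eq_iff smult_0_right)
  ultimately have "degree m = 0"
    using gh(1) by (simp add: m degree_mult_eq)
  then obtain u where u: "m = [:u:]"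
    by (elim degree_eq_zeroE)
  have "smult (\<zeta> ^ n) (coeff g n) = u * coeff g n" for n
    using arg_cong[OF m, of "\<lambda>p. coeff p n"] by (simp add: coeff_sc u)
  \<comment> \<open>At n = 0 the identity reads \<open>coeff g 0 = u * coeff g 0\<close>, which
    forces u = 1.\<close>
  from this[of 0] this have \<zeta>g: "smult (\<zeta> ^ n) (coeff g n) = coeff g n" for n
    using g0 by simp
  have dvd: "k dvd n" if "coeff g n \<noteq> 0" for n
  proof -
    have "smult (\<zeta> ^ n - 1) (coeff g n) = 0"
      using \<zeta>g[of n] by (simp add: smult_diff_left)
    then show ?thesis
      using that \<zeta>[of n] by simp
  qed
  have "degree g + degree h = 2 * k"
    using deg_f gh by (simp add: h degree_mult_eq)
  have "k dvd degree g"
    by (rule dvd) (use gh in simp)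
  have "degree g \<noteq> 0"
  proof
    assume "degree g = 0"
    then obtain v where "g = [:v:]"
      by (elim degree_eq_zeroE)
    then have "is_unit g"
      using unit(1) by (simp add: is_unit_const_poly_iff)
    then show False
      using g(1) by (simp add: prime_elem_def)
  qed
  have "degree g \<noteq> k"
  proof
    assume deg: "degree g = k"
    obtain v where v: "coeff g k = [:v:]" "v \<noteq> 0"
      using is_unit_polyE[OF unit(1)] deg by (metis dvd_0_left_iff one_neq_zero)
    define r where "r = smult (- inverse v) (coeff g 0)"
    have g_eq: "g = monom [:v:] k + [:coeff g 0:]"
    proof (rule poly_eqI)
      fix n
      have "coeff g n = 0" if "n \<noteq> 0" "n \<noteq> k"
      proof (rule ccontr)
        assume *: "coeff g n \<noteq> 0"
        then have "n \<le> k"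
          using deg le_degree by blast
        then show False
          using dvd[OF *] that dvd_imp_le[of k n] by auto
      qed
      then show "coeff g n = coeff (monom [:v:] k + [:coeff g 0:]) n"
        using v(1) k by (cases "n = 0"; cases "n = k") (auto simp: coeff_pCons split: nat.splits)
    qed
    \<comment> \<open>The polynomial \<open>r\<close> need not have a k-th root, but each of its
      values does: with y^k = r(x), \<open>g\<close> and hence \<open>f\<close> vanish at (x, y). So
      r is a root of b T^2 + B T + C, which makes the discriminant the square of 2 b r + B.\<close>
    have "poly (smult b (r\<^sup>2) + B * r + C) x = 0" for x
    proof -
      obtain y where y: "y ^ k = poly r x"
        using nth_root_exists[of k] k by auto
      have "poly (poly g [:y:]) x = v * y ^ k + poly (coeff g 0) x"
        by (subst g_eq) (simp add: poly_monom poly_const_pow)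
      also have "\<dots> = 0"
        using v(2) by (simp add: y r_def)
      finally have "poly (poly f [:y:]) x = 0"
        by (simp add: h)
      moreover have "poly (poly f [:y:]) x = b * (y ^ k)\<^sup>2 + poly B x * y ^ k + poly C x"
        by (simp add: f_def poly_monom poly_const_pow mult.commute flip: power_mult)
      ultimately show ?thesis
        by (simp add: y)
    qed
    then have root: "smult b (r\<^sup>2) + B * r + C = 0"
      using poly_all_0_iff_0 by blast
    have "(smult (2 * b) r + B)\<^sup>2 = smult (4 * b) (smult b (r\<^sup>2) + B * r + C) + (B\<^sup>2 - smult (4 * b) C)"
      unfolding poly_eq_poly_eq_iff[symmetric] fun_eq_iff by (simp add: power2_eq_square algebra_simps)
    then have "B\<^sup>2 - smult (4 * b) C = (smult (2 * b) r + B)\<^sup>2"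
      by (simp add: root)
    then show False
      using D square_root_not_simple by metis
  qed
  have "degree h = 0"
  proof -
    obtain t where t: "degree g = k * t"
      using \<open>k dvd degree g\<close> by (elim dvdE)
    have "t \<noteq> 0" "t \<noteq> 1"
      using t \<open>degree g \<noteq> 0\<close> \<open>degree g \<noteq> k\<close> by auto
    then have "k * 2 \<le> degree g"
      unfolding t by (intro mult_le_mono2) linarith
    then show ?thesis
      using \<open>degree g + degree h = 2 * k\<close> by linarith
  qed
  then obtain w where "h = [:w:]"
    by (elim degree_eq_zeroE)
  then have "is_unit h"
    using unit(2) by (simp add: is_unit_const_poly_iff)
  then show ?thesis
    using g(1) prime_elem_mult_unit_left[of h g] by (simp add: h mult.commute)
qed

text \<open>Bezout's identity over the field of fractions with the denominators cleared. A nonzero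
  element of least degree in the ideal of f and R plays the role of the gcd: by pseudo-division it
  divides a constant multiple of every element. If f divided it, f would divide R; so it divides a
  nonzero constant and has degree 0.\<close>

lemma prime_elem_elimination:
  fixes f R :: "'a::field_gcd poly poly"
  assumes f: "prime_elem f" "degree f > 0" and R: "\<not> f dvd R"
  shows "\<exists>u v r. r \<noteq> 0 \<and> u * f + v * R = [:r:]"
proof -
  define I where "I = {u * f + v * R | u v. True}"
  have "f \<noteq> 0"
    using f(2) by auto
  have "f \<in> I" "R \<in> I"
    unfolding I_def by (auto intro: exI[of _ 1] exI[of _ 0])
  define m where "m = arg_min degree (\<lambda>p. p \<in> I \<and> p \<noteq> 0)"
  have m: "m \<in> I" "m \<noteq> 0" and min: "\<And>p. p \<in> I \<Longrightarrow> p \<noteq> 0 \<Longrightarrow> degree m \<le> degree p"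
    using arg_min_nat_lemma[of "\<lambda>p. p \<in> I \<and> p \<noteq> 0" f degree] \<open>f \<in> I\<close> \<open>f \<noteq> 0\<close>
    unfolding m_def by auto
  have div: "\<exists>a q. a \<noteq> 0 \<and> smult a p = m * q" if "p \<in> I" for p
  proof -
    obtain a q where aq: "a \<noteq> 0" "smult a p = m * q + pseudo_mod p m"
      using pseudo_mod(1)[OF m(2)] by blast
    have "pseudo_mod p m = [:a:] * p - q * m"
      using aq(2) by (simp add: mult.commute)
    also have "\<dots> \<in> I"
    proof -
      obtain u v where "p = u * f + v * R"
        using \<open>p \<in> I\<close> unfolding I_def by blast
      moreover obtain u' v' where "m = u' * f + v' * R"
        using m(1) unfolding I_def by blast
      ultimately have "[:a:] * p - q * m = ([:a:] * u - q * u') * f + ([:a:] * v - q * v') * R"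
        by (simp only: algebra_simps)
      then show ?thesis
        unfolding I_def by blast
    qed
    finally have "pseudo_mod p m = 0"
      using min pseudo_mod(2)[OF m(2)] by fastforce
    then show ?thesis
      using aq by auto
  qed
  have "degree m = 0"
  proof -
    obtain a q where aq: "a \<noteq> 0" "smult a f = m * q"
      using div[OF \<open>f \<in> I\<close>] by blast
    then have "f dvd m * q"
      by (metis dvd_smult dvd_refl)
    then consider "f dvd m" | "f dvd q"
      using f(1) prime_elem_dvd_multD by blast
    then show ?thesis
    proof cases
      case 1
      obtain c s where cs: "c \<noteq> 0" "smult c R = m * s"
        using div[OF \<open>R \<in> I\<close>] by blast
      then have "f dvd [:c:] * R"
        using 1 by simp
      moreover have "\<not> f dvd [:c:]"
        using f(2) cs(1) by (auto dest: dvd_imp_degree_le)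
      ultimately show ?thesis
        using f(1) R prime_elem_dvd_multD by blast
    next
      case 2
      then obtain t where "q = f * t"
        by (elim dvdE)
      then have "f * [:a:] = f * (m * t)"
        using aq(2) by (simp add: mult_ac)
      then have "[:a:] = m * t"
        using \<open>f \<noteq> 0\<close> by (simp only: mult_cancel_left simp_thms)
      then have "degree (m * t) = 0" "m * t \<noteq> 0"
        using aq(1) by (metis degree_pCons_0, metis pCons_eq_0_iff)
      then show ?thesis
        by (simp add: degree_mult_eq)
    qed
  qed
  then obtain r where "m = [:r:]"
    by (elim degree_eq_zeroE)
  moreover obtain u v where "m = u * f + v * R"
    using m(1) unfolding I_def by blast
  ultimately show ?thesis
    using m(2) by (intro exI[of _ u] exI[of _ v] exI[of _ r]) auto
qed

text \<open>If the prime polynomial of the curve divided neither P nor Q, elimination would give a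
  nonzero r(x) vanishing at the first coordinate of every point of the curve. But every x is such a
  coordinate, since b \<noteq> 0 leaves an equation of degree 2 k for y.\<close>

lemma conic_in_powers_irreducible:
  fixes a b c d e g :: complex and P Q :: "complex poly poly"
  assumes k: "k \<ge> 1"
    and nz: "a \<noteq> 0" "b \<noteq> 0" "c \<noteq> 0" "d\<^sup>2 \<noteq> a * b" "e\<^sup>2 \<noteq> a * c" "g\<^sup>2 \<noteq> b * c"
      "a * b * c + 2 * d * e * g - a * g\<^sup>2 - b * e\<^sup>2 - c * d\<^sup>2 \<noteq> 0"
  defines "F \<equiv> \<lambda>x y. a * (x ^ k)\<^sup>2 + b * (y ^ k)\<^sup>2 + c + 2 * d * x ^ k * y ^ k + 2 * e * x ^ k + 2 * g * y ^ k"
  assumes PQ: "\<And>x y. F x y = 0 \<Longrightarrow> poly (poly P [:y:]) x = 0 \<or> poly (poly Q [:y:]) x = 0"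
  shows "(\<forall>x y. F x y = 0 \<longrightarrow> poly (poly P [:y:]) x = 0) \<or> (\<forall>x y. F x y = 0 \<longrightarrow> poly (poly Q [:y:]) x = 0)"
proof -
  define B where "B = monom (2 * d) k + [:2 * g:]"
  define C where "C = monom a (2 * k) + monom (2 * e) k + [:c:]"
  define f where "f = monom [:b:] (2 * k) + monom B k + [:C:]"
  have pow: "x ^ (2 * k) = (x ^ k)\<^sup>2" for x :: complex
    by (simp add: mult.commute flip: power_mult)
  have B: "poly B x = 2 * d * x ^ k + 2 * g" and C: "poly C x = a * (x ^ k)\<^sup>2 + 2 * e * x ^ k + c" for x
    by (simp_all add: B_def C_def poly_monom pow)
  have f: "poly (poly f [:y:]) x = F x y" for x y
    by (simp add: f_def F_def poly_monom poly_const_pow pow B C) (simp add: algebra_simps)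
  have disc: "B\<^sup>2 - smult (4 * b) C =
      monom (4 * (d\<^sup>2 - a * b)) (2 * k) + monom (2 * (4 * (d * g - b * e))) k + [:4 * (g\<^sup>2 - b * c):]"
    unfolding poly_eq_poly_eq_iff[symmetric] fun_eq_iff
    by (simp add: B C poly_monom pow) (simp add: power2_eq_square algebra_simps)
  \<comment> \<open>The discriminant in y^k is itself a quadratic in x^k. Its own discriminant is,
    up to a factor 4, -16 b times the determinant of the conic, so nondegeneracy provides the simple
    root \<open>x1\<close>.\<close>
  have "(4 * (d * g - b * e))\<^sup>2 - 4 * (d\<^sup>2 - a * b) * (4 * (g\<^sup>2 - b * c)) =
      - 16 * b * (a * b * c + 2 * d * e * g - a * g\<^sup>2 - b * e\<^sup>2 - c * d\<^sup>2)"
    by (simp add: power2_eq_square algebra_simps)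
  also have "\<dots> \<noteq> 0"
    using nz(2,7) by simp
  finally have det: "(4 * (d * g - b * e))\<^sup>2 \<noteq> 4 * (d\<^sup>2 - a * b) * (4 * (g\<^sup>2 - b * c))"
    by simp
  obtain x0 where x0: "poly C x0 = 0" "poly (pderiv C) x0 \<noteq> 0"
    using simple_root_exists[of k a c e] k nz(1,3,5) unfolding C_def by auto
  obtain x1 where x1: "poly (B\<^sup>2 - smult (4 * b) C) x1 = 0" "poly (pderiv (B\<^sup>2 - smult (4 * b) C)) x1 \<noteq> 0"
    unfolding disc using simple_root_exists[OF _ _ _ det, of k] k nz(4,6) by auto
  have prime: "prime_elem f"
    unfolding f_def by (rule prime_elem_quadratic_in_power[OF k nz(2) x0 x1])
  have coeff_f: "coeff f (2 * k) = [:b:]"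
    using k by (simp add: f_def coeff_pCons split: nat.splits)
  then have deg_f: "degree f > 0"
    using k le_degree[of f "2 * k"] nz(2) by simp
  consider "f dvd P" | "f dvd Q" | "\<not> f dvd P * Q"
    using prime prime_elem_dvd_multD by blast
  then show ?thesis
  proof cases
    case 3
    then obtain u v r where uvr: "r \<noteq> 0" "u * f + v * (P * Q) = [:r:]"
      using prime_elem_elimination[OF prime deg_f] by blast
    obtain x where x: "poly r x \<noteq> 0"
      using uvr(1) poly_all_0_iff_0[of r] by blast
    define h where "h = monom b (2 * k) + monom (poly B x) k + [:poly C x:]"
    have "coeff h (2 * k) = b"
      using k by (simp add: h_def coeff_pCons split: nat.splits)
    then have "degree h > 0"
      using k le_degree[of h "2 * k"] nz(2) by simp
    then obtain y where "poly h y = 0"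
      using poly_root_exists by blast
    then have y: "F x y = 0"
      by (simp add: h_def F_def poly_monom pow B C) (simp add: algebra_simps)
    have "poly (poly (u * f + v * (P * Q)) [:y:]) x = 0"
      using PQ[OF y] by (auto simp: f y)
    then show ?thesis
      using x by (simp add: uvr(2))
  next
    case 1
    then obtain m where "P = f * m"
      by (elim dvdE)
    then show ?thesis
      by (simp add: f)
  next
    case 2
    then obtain m where "Q = f * m"
      by (elim dvdE)
    then show ?thesis
      by (simp add: f)
  qed
qed

section \<open>Hilbert polynomials of plane curves\<close>

text \<open>Cancellation may shrink the support of a sum, so the three sums are first extended by
  zero terms to the union of the supports. Degrees, values and Euler operators are all sums of this
  shape and become additive.\<close>

lemma sum_keys_add:
  fixes p q :: "'b \<Rightarrow>\<^sub>0 'c::monoid_add" and F :: "'b \<Rightarrow> 'c \<Rightarrow> 'd::comm_monoid_add"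
  assumes "\<And>t. F t 0 = 0" "\<And>t a b. F t (a + b) = F t a + F t b"
  shows "(\<Sum>t\<in>Poly_Mapping.keys (p + q). F t (Poly_Mapping.lookup (p + q) t)) =
    (\<Sum>t\<in>Poly_Mapping.keys p. F t (Poly_Mapping.lookup p t)) +
    (\<Sum>t\<in>Poly_Mapping.keys q. F t (Poly_Mapping.lookup q t))"
proof -
  let ?K = "Poly_Mapping.keys p \<union> Poly_Mapping.keys q"
  have ext: "(\<Sum>t\<in>Poly_Mapping.keys r. F t (Poly_Mapping.lookup r t)) = (\<Sum>t\<in>?K. F t (Poly_Mapping.lookup r t))"
    if "Poly_Mapping.keys r \<subseteq> ?K" for r
    using that by (intro sum.mono_neutral_left) (auto simp: in_keys_iff assms(1))
  show ?thesis
    unfolding ext[OF Poly_Mapping.keys_add] ext[OF Un_upper1] ext[OF Un_upper2]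
    by (simp add: lookup_add assms(2) sum.distrib)
qed

lemma total_deg_add: "total_deg (s + t) = total_deg s + total_deg t"
  unfolding total_deg_def by (rule sum_keys_add) auto

lemma total_deg_single [simp]: "total_deg (Poly_Mapping.single i m) = m"
  by (simp add: total_deg_def)

lemma total_deg_eq_sum:
  assumes "Poly_Mapping.keys t \<subseteq> {..N}"
  shows "total_deg t = (\<Sum>i\<le>N. Poly_Mapping.lookup t i)"
  unfolding total_deg_def using assms
  by (intro sum.mono_neutral_left) (auto simp: in_keys_iff)

interpretation mvpoly: vector_space "mvpoly_scale :: 'a::field \<Rightarrow> 'a mvpoly \<Rightarrow> 'a mvpoly"
  by (rule vector_space_mvpoly_scale)

lemma lookup_mvpoly_scale: "Poly_Mapping.lookup (mvpoly_scale c p) t = c * Poly_Mapping.lookup p t"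
  by (simp add: mvpoly_scale_def mult_map_scale_conv_mult[symmetric] map.rep_eq when_def)

lemma mvpoly_eq_sum_monomials:
  "p = (\<Sum>t\<in>Poly_Mapping.keys p. mvpoly_scale (Poly_Mapping.lookup p t) (Poly_Mapping.single t 1))"
proof (rule poly_mapping_eqI)
  fix s
  have "(\<Sum>t\<in>Poly_Mapping.keys p. Poly_Mapping.lookup p t * (1 when t = s)) =
      (\<Sum>t\<in>Poly_Mapping.keys p. if t = s then Poly_Mapping.lookup p t else 0)"
    by (intro sum.cong) (auto simp: when_def)
  then show "Poly_Mapping.lookup p s = Poly_Mapping.lookup
      (\<Sum>t\<in>Poly_Mapping.keys p. mvpoly_scale (Poly_Mapping.lookup p t) (Poly_Mapping.single t 1)) s"
    by (simp add: lookup_sum lookup_mvpoly_scale lookup_single in_keys_iff)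
qed

definition monomials :: "nat \<Rightarrow> nat \<Rightarrow> (nat \<Rightarrow>\<^sub>0 nat) set" where
  "monomials N m = {t. Poly_Mapping.keys t \<subseteq> {..N} \<and> total_deg t = m}"

lemma mem_forms_iff: "p \<in> forms N m \<longleftrightarrow> Poly_Mapping.keys p \<subseteq> monomials N m"
  by (auto simp: forms_def polys_def monomials_def)

lemma card_pairs_sum_le: "2 * card (SIGMA a:{..m}. {..m - a}) = (m + 1) * (m + 2)"
proof -
  have "card (SIGMA a:{..m}. {..m - a}) = (\<Sum>a\<le>m. Suc (m - a))"
    by simp
  also have "\<dots> = (\<Sum>a\<le>m. Suc a)"
    by (rule sum.reindex_bij_witness[of _ "\<lambda>a. m - a" "\<lambda>a. m - a"]) auto
  also have "2 * \<dots> = (m + 1) * (m + 2)"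
    by (induction m) auto
  finally show ?thesis .
qed

text \<open>The exponents a and b of the first two variables determine the third one, m - a -
  b.\<close>

lemma card_monomials_2: "finite (monomials 2 m)" "2 * card (monomials 2 m) = (m + 1) * (m + 2)"
proof -
  define \<phi> where "\<phi> t = (Poly_Mapping.lookup t 0, Poly_Mapping.lookup t 1)" for t :: "nat \<Rightarrow>\<^sub>0 nat"
  define \<psi> where "\<psi> = (\<lambda>(a, b). Poly_Mapping.single 0 a + Poly_Mapping.single 1 b
    + Poly_Mapping.single 2 (m - a - b) :: nat \<Rightarrow>\<^sub>0 nat)"
  have deg: "total_deg t = Poly_Mapping.lookup t 0 + Poly_Mapping.lookup t 1 + Poly_Mapping.lookup t 2"
    if "Poly_Mapping.keys t \<subseteq> {..2}" for t
    using total_deg_eq_sum[OF that] by (simp add: numeral_2_eq_2)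
  have "bij_betw \<phi> (monomials 2 m) (SIGMA a:{..m}. {..m - a})"
  proof (rule bij_betw_byWitness[where f' = \<psi>])
    show "\<forall>t\<in>monomials 2 m. \<psi> (\<phi> t) = t"
    proof
      fix t assume "t \<in> monomials 2 m"
      then have t: "Poly_Mapping.keys t \<subseteq> {..2}" "total_deg t = m"
        by (auto simp: monomials_def)
      show "\<psi> (\<phi> t) = t"
      proof (rule poly_mapping_eqI)
        fix i :: nat
        consider "i = 0" | "i = 1" | "i = 2" | "i > 2"
          by linarith
        then show "Poly_Mapping.lookup (\<psi> (\<phi> t)) i = Poly_Mapping.lookup t i"
        proof cases
          case 4
          then have "i \<notin> Poly_Mapping.keys t"
            using t(1) by auto
          then show ?thesis
            using 4 by (simp add: \<psi>_def \<phi>_def lookup_add lookup_single in_keys_iff)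
        qed (use deg[OF t(1)] t(2) in \<open>simp_all add: \<psi>_def \<phi>_def lookup_add lookup_single\<close>)
      qed
    qed
    show "\<forall>ab\<in>SIGMA a:{..m}. {..m - a}. \<phi> (\<psi> ab) = ab"
      by (auto simp: \<phi>_def \<psi>_def lookup_add lookup_single)
    show "\<phi> ` monomials 2 m \<subseteq> (SIGMA a:{..m}. {..m - a})"
      using deg by (auto simp: monomials_def \<phi>_def)
    show "\<psi> ` (SIGMA a:{..m}. {..m - a}) \<subseteq> monomials 2 m"
    proof (rule image_subsetI, elim SigmaE, simp only:)
      fix a b assume ab: "a \<in> {..m}" "b \<in> {..m - a}"
      have "total_deg (\<psi> (a, b)) = m"
        using ab by (simp add: \<psi>_def total_deg_add)
      moreover have "Poly_Mapping.keys (\<psi> (a, b)) \<subseteq> {..2}"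
        by (auto simp: \<psi>_def in_keys_iff lookup_add lookup_single when_def split: if_splits)
      ultimately show "\<psi> (a, b) \<in> monomials 2 m"
        by (simp add: monomials_def)
    qed
  qed
  then show "finite (monomials 2 m)" "2 * card (monomials 2 m) = (m + 1) * (m + 2)"
    using card_pairs_sum_le[of m] by (simp_all add: bij_betw_finite bij_betw_same_card)
qed

lemma independent_monomials:
  fixes f :: "'a::field mvpoly"
  assumes "finite T" "f \<noteq> 0"
  shows "mvpoly.independent ((\<lambda>t. Poly_Mapping.single t 1 * f) ` T)"
    "card ((\<lambda>t. Poly_Mapping.single t 1 * f) ` T) = card T"
proof -
  have inj: "inj_on (\<lambda>t. Poly_Mapping.single t 1 * f) T"
    using assms(2) by (auto simp: inj_on_def)
      (metis lookup_single_eq lookup_single_not_eq one_neq_zero)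
  then show "card ((\<lambda>t. Poly_Mapping.single t 1 * f) ` T) = card T"
    by (rule card_image)
  show "mvpoly.independent ((\<lambda>t. Poly_Mapping.single t 1 * f) ` T)"
  proof (rule mvpoly.independent_if_scalars_zero)
    fix u x
    assume sum: "(\<Sum>x\<in>(\<lambda>t. Poly_Mapping.single t 1 * f) ` T. mvpoly_scale (u x) x) = 0"
      and "x \<in> (\<lambda>t. Poly_Mapping.single t 1 * f) ` T"
    then obtain s where s: "s \<in> T" "x = Poly_Mapping.single s 1 * f"
      by auto
    define g where "g = (\<Sum>t\<in>T. mvpoly_scale (u (Poly_Mapping.single t 1 * f)) (Poly_Mapping.single t 1))"
    have "g * f = 0"
      using sum unfolding sum.reindex[OF inj] g_def
      by (simp add: sum_distrib_right mvpoly_scale_def mult.assoc)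
    then have "g = 0"
      using assms(2) by simp
    moreover have "Poly_Mapping.lookup g s = (\<Sum>t\<in>T. if t = s then u (Poly_Mapping.single t 1 * f) else 0)"
      unfolding g_def lookup_sum by (intro sum.cong) (auto simp: lookup_mvpoly_scale lookup_single when_def)
    ultimately show "u x = 0"
      using s assms(1) by simp
  qed (use assms in simp)
qed

text \<open>Multiplication by a nonzero polynomial is injective, so the dimension is that of the
  forms of degree m; f = 1 gives the space of forms itself.\<close>

lemma dim_multiples_of_forms:
  fixes f :: "'a::field mvpoly"
  assumes "finite (monomials N m)" "f \<noteq> 0"
  shows "mvpoly.dim ((\<lambda>h. h * f) ` forms N m) = card (monomials N m)"
proof (rule mvpoly.dim_unique)
  let ?B = "(\<lambda>t. Poly_Mapping.single t 1 * f) ` monomials N m"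
  show "mvpoly.independent ?B" "card ?B = card (monomials N m)"
    using independent_monomials[OF assms] by auto
  show "?B \<subseteq> (\<lambda>h. h * f) ` forms N m"
    by (auto simp: mem_forms_iff)
  show "(\<lambda>h. h * f) ` forms N m \<subseteq> mvpoly.span ?B"
  proof clarify
    fix h :: "'a mvpoly" assume h: "h \<in> forms N m"
    have "h * f = (\<Sum>t\<in>Poly_Mapping.keys h. mvpoly_scale (Poly_Mapping.lookup h t) (Poly_Mapping.single t 1 * f))"
      by (subst mvpoly_eq_sum_monomials[of h]) (simp add: sum_distrib_right mvpoly_scale_def mult.assoc)
    also have "\<dots> \<in> mvpoly.span ?B"
      using h by (intro mvpoly.span_sum mvpoly.span_scale mvpoly.span_base) (auto simp: mem_forms_iff)
    finally show "h * f \<in> mvpoly.span ?B" .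
  qed
qed

lemma form_mult:
  fixes f h :: "'a::comm_semiring_0 mvpoly"
  assumes "h \<in> forms N m" "f \<in> forms N D"
  shows "h * f \<in> forms N (m + D)"
  unfolding mem_forms_iff
proof
  fix t assume "t \<in> Poly_Mapping.keys (h * f)"
  then obtain a b where ab: "t = a + b" "a \<in> Poly_Mapping.keys h" "b \<in> Poly_Mapping.keys f"
    using keys_mult[of h f] by auto
  then have "a \<in> monomials N m" "b \<in> monomials N D"
    using assms by (auto simp: mem_forms_iff)
  then show "t \<in> monomials N (m + D)"
    using Poly_Mapping.keys_add[of a b] by (auto simp: monomials_def ab total_deg_add)
qed

text \<open>A multiplier h need not be homogeneous, but its part h1 of degree m suffices: (h - h1) f
  lies in degree m + D although h - h1 has no term of degree m, so this product is 0.\<close>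

lemma gen_ideal_singleton_Int_forms:
  fixes f :: "'a::idom mvpoly"
  assumes f: "f \<in> forms N D"
  shows "gen_ideal N {f} \<inter> forms N (m + D) = (\<lambda>h. h * f) ` forms N m"
proof
  show "(\<lambda>h. h * f) ` forms N m \<subseteq> gen_ideal N {f} \<inter> forms N (m + D)"
  proof clarify
    fix h :: "'a mvpoly" assume h: "h \<in> forms N m"
    then have "h \<in> polys N"
      by (simp add: forms_def)
    then have "h * f \<in> gen_ideal N {f}"
      unfolding gen_ideal_def by (auto intro!: exI[of _ "\<lambda>_. h"])
    then show "h * f \<in> gen_ideal N {f} \<inter> forms N (m + D)"
      using form_mult[OF h f] by simp
  qed
  show "gen_ideal N {f} \<inter> forms N (m + D) \<subseteq> (\<lambda>h. h * f) ` forms N m"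
  proof
    fix p assume p: "p \<in> gen_ideal N {f} \<inter> forms N (m + D)"
    then obtain h where h: "h \<in> polys N" "p = h * f"
      by (auto simp: gen_ideal_def)
    define h1 where "h1 = Poly_Mapping.mapp (\<lambda>t c. c when total_deg t = m) h"
    have lookup_h1: "Poly_Mapping.lookup h1 t = (Poly_Mapping.lookup h t when total_deg t = m)" for t
      by (simp add: h1_def lookup_mapp when_def in_keys_iff)
    have "h1 \<in> forms N m"
      using h(1) by (auto simp: mem_forms_iff monomials_def polys_def in_keys_iff lookup_h1)
    define h2 where "h2 = h - h1"
    have "h2 * f = p - h1 * f"
      by (simp add: h2_def h(2) algebra_simps)
    have "Poly_Mapping.keys (h2 * f) = {}"
    proof (rule ccontr)
      assume "Poly_Mapping.keys (h2 * f) \<noteq> {}"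
      then obtain t where t: "t \<in> Poly_Mapping.keys (h2 * f)"
        by blast
      then obtain a b where ab: "t = a + b" "a \<in> Poly_Mapping.keys h2" "b \<in> Poly_Mapping.keys f"
        using keys_mult[of h2 f] by auto
      have "total_deg b = D"
        using ab(3) f by (auto simp: mem_forms_iff monomials_def)
      moreover have "total_deg a \<noteq> m"
        using ab(2) by (auto simp: in_keys_iff h2_def lookup_minus lookup_h1)
      moreover have "t \<in> Poly_Mapping.keys p \<union> Poly_Mapping.keys (h1 * f)"
        using t unfolding \<open>h2 * f = p - h1 * f\<close> by (auto simp: in_keys_iff lookup_minus)
      then have "total_deg t = m + D"
        using p form_mult[OF \<open>h1 \<in> forms N m\<close> f] by (auto simp: mem_forms_iff monomials_def)
      ultimately show False
        by (simp add: ab(1) total_deg_add)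
    qed
    then have "p = h1 * f"
      using \<open>h2 * f = p - h1 * f\<close> by simp
    then show "p \<in> (\<lambda>h. h * f) ` forms N m"
      using \<open>h1 \<in> forms N m\<close> by blast
  qed
qed

text \<open>The difference of the binomial coefficients (m + D + 2 choose 2) and (m + 2 choose 2),
  rewritten in m + D. One minus the constant term is (D - 1) (D - 2) / 2, the genus of a smooth
  plane curve of degree D.\<close>

lemma hilbert_function_plane_curve:
  assumes f: "f \<in> forms 2 D" "f \<noteq> 0"
  shows "of_nat (hilbert_function 2 {f} (m + D)) = poly [:of_nat D * (3 - of_nat D) / 2, of_nat D:] (of_nat (m + D) :: rat)"
proof -
  have "mvpoly.dim (forms 2 (m + D) :: rat mvpoly set) = card (monomials 2 (m + D))"
    using dim_multiples_of_forms[of 2 "m + D" "1 :: rat mvpoly"] card_monomials_2(1) by simp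
  then have H: "hilbert_function 2 {f} (m + D) = card (monomials 2 (m + D)) - card (monomials 2 m)"
    unfolding hilbert_function_def gen_ideal_singleton_Int_forms[OF f(1)]
    by (simp add: dim_multiples_of_forms card_monomials_2(1) f(2))
  have "2 * card (monomials 2 m) \<le> 2 * card (monomials 2 (m + D))"
    unfolding card_monomials_2 by (intro mult_mono) auto
  moreover have "2 * rat_of_nat (card (monomials 2 n)) = (of_nat n + 1) * (of_nat n + 2)" for n
    using arg_cong[OF card_monomials_2(2)[of n], of rat_of_nat] by (simp add: algebra_simps)
  ultimately have "2 * rat_of_nat (hilbert_function 2 {f} (m + D)) =
      (of_nat (m + D) + 1) * (of_nat (m + D) + 2) - (of_nat m + 1) * (of_nat m + 2)"
    unfolding H by (simp add: of_nat_diff right_diff_distrib)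
  then show ?thesis
    by (simp add: field_simps)
qed

lemma is_hilbert_polynomial_plane_curve:
  assumes "f \<in> forms 2 D" "f \<noteq> 0"
  shows "is_hilbert_polynomial 2 {f} [:of_nat D * (3 - of_nat D) / 2, of_nat D:]"
  unfolding is_hilbert_polynomial_def eventually_sequentially
  using hilbert_function_plane_curve[OF assms] by (metis le_add_diff_inverse2)

section \<open>Smooth plane curves over conics\<close>

definition monomial_value :: "(nat \<Rightarrow> 'a::comm_semiring_1) \<Rightarrow> (nat \<Rightarrow>\<^sub>0 nat) \<Rightarrow> 'a" where
  "monomial_value v t = (\<Prod>i\<in>Poly_Mapping.keys t. v i ^ Poly_Mapping.lookup t i)"

lemma monomial_value_eq_prod:
  assumes "finite I" "Poly_Mapping.keys t \<subseteq> I"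
  shows "monomial_value v t = (\<Prod>i\<in>I. v i ^ Poly_Mapping.lookup t i)"
  unfolding monomial_value_def using assms
  by (intro prod.mono_neutral_left) (auto simp: in_keys_iff)

lemma monomial_value_add: "monomial_value v (s + t) = monomial_value v s * monomial_value v t"
proof -
  let ?I = "Poly_Mapping.keys s \<union> Poly_Mapping.keys t"
  have "monomial_value v (s + t) = (\<Prod>i\<in>?I. v i ^ Poly_Mapping.lookup (s + t) i)"
    by (rule monomial_value_eq_prod) (use Poly_Mapping.keys_add[of s t] in auto)
  also have "\<dots> = (\<Prod>i\<in>?I. v i ^ Poly_Mapping.lookup s i) * (\<Prod>i\<in>?I. v i ^ Poly_Mapping.lookup t i)"
    by (simp add: lookup_add power_add prod.distrib)
  also have "\<dots> = monomial_value v s * monomial_value v t"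
    by (subst (1 2) monomial_value_eq_prod[of ?I]) auto
  finally show ?thesis .
qed

lemma monomial_value_single [simp]: "monomial_value v (Poly_Mapping.single i m) = v i ^ m"
  by (simp add: monomial_value_def)

lemma eval_mvpoly_eq:
  "eval_mvpoly p v = (\<Sum>t\<in>Poly_Mapping.keys p. Poly_Mapping.lookup p t * monomial_value v t)"
  by (simp add: eval_mvpoly_def monomial_value_def)

lemma eval_mvpoly_add: "eval_mvpoly (p + q) v = eval_mvpoly p v + eval_mvpoly q v"
  unfolding eval_mvpoly_eq by (rule sum_keys_add) (auto simp: algebra_simps)

lemma eval_mvpoly_zero [simp]: "eval_mvpoly 0 v = 0"
  by (simp add: eval_mvpoly_def)

lemma eval_mvpoly_sum: "eval_mvpoly (\<Sum>x\<in>A. f x) v = (\<Sum>x\<in>A. eval_mvpoly (f x) v)"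
  using sum_comp_morphism[of "\<lambda>p. eval_mvpoly p v" f A]
  by (simp add: eval_mvpoly_add comp_def)

lemma eval_mvpoly_single [simp]: "eval_mvpoly (Poly_Mapping.single t c) v = c * monomial_value v t"
  by (simp add: eval_mvpoly_eq)

lemma monomial_value_scale:
  "monomial_value (coord_scale c v) t = c ^ total_deg t * monomial_value v t"
  by (simp add: monomial_value_def coord_scale_def power_mult_distrib prod.distrib total_deg_def power_sum)

lemma eval_form_scale:
  assumes "p \<in> forms N m"
  shows "eval_mvpoly p (coord_scale c v) = c ^ m * eval_mvpoly p v"
  unfolding eval_mvpoly_eq sum_distrib_left
  using assms by (intro sum.cong) (auto simp: monomial_value_scale forms_def)

text \<open>The Euler operator is diagonal on monomials: the extra factor \<open>v i\<close> undoes
  the lowering of the exponent, and the truncated case has coefficient 0.\<close>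

lemma mult_eval_partial_deriv:
  "v i * eval_mvpoly (partial_deriv i p) v =
    (\<Sum>t\<in>Poly_Mapping.keys p. of_nat (Poly_Mapping.lookup t i) * Poly_Mapping.lookup p t * monomial_value v t)"
proof -
  have *: "v i * (of_nat (Poly_Mapping.lookup t i) * c * monomial_value v (t - Poly_Mapping.single i 1)) =
      of_nat (Poly_Mapping.lookup t i) * c * monomial_value v t" for t c
  proof (cases "Poly_Mapping.lookup t i = 0")
    case False
    then have "t = Poly_Mapping.single i 1 + (t - Poly_Mapping.single i 1)"
      by (intro poly_mapping_eqI) (auto simp: lookup_add lookup_minus lookup_single when_def)
    then have "monomial_value v t = v i * monomial_value v (t - Poly_Mapping.single i 1)"
      by (metis monomial_value_add monomial_value_single power_one_right)
    then show ?thesis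
      by (simp add: mult_ac)
  qed simp
  show ?thesis
    unfolding partial_deriv_def eval_mvpoly_sum sum_distrib_left
    by (simp only: eval_mvpoly_single *)
qed

lemma lookup_complexify: "Poly_Mapping.lookup (complexify p) t = of_rat (Poly_Mapping.lookup p t)"
  by (simp add: complexify_def map.rep_eq when_def)

text \<open>\<open>q\<close> is the symmetric matrix of the conic. Both orders of i and j are
  summed, so mixed terms carry 2 * q i j.\<close>

definition conic_in_powers :: "nat \<Rightarrow> (nat \<Rightarrow> nat \<Rightarrow> 'a) \<Rightarrow> 'a::comm_semiring_1 mvpoly" where
  "conic_in_powers k q =
     (\<Sum>i\<le>2. \<Sum>j\<le>2. Poly_Mapping.single (Poly_Mapping.single i k + Poly_Mapping.single j k) (q i j))"

lemma eval_conic_in_powers: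
  "eval_mvpoly (conic_in_powers k q) v = (\<Sum>i\<le>2. \<Sum>j\<le>2. q i j * (v i ^ k * v j ^ k))"
  by (simp add: conic_in_powers_def eval_mvpoly_sum monomial_value_add)

lemma complexify_conic_in_powers:
  "complexify (conic_in_powers k q) = conic_in_powers k (\<lambda>i j. of_rat (q i j))"
  by (rule poly_mapping_eqI)
     (simp add: lookup_complexify conic_in_powers_def lookup_sum lookup_single of_rat_sum when_def
        if_distrib[of of_rat] cong: if_cong)

lemma conic_in_powers_in_forms: "conic_in_powers k q \<in> forms 2 (2 * k)"
  unfolding mem_forms_iff
proof
  fix t assume "t \<in> Poly_Mapping.keys (conic_in_powers k q)"
  then have "(\<Sum>i\<le>2. \<Sum>j\<le>2. Poly_Mapping.lookup
      (Poly_Mapping.single (Poly_Mapping.single i k + Poly_Mapping.single j k) (q i j)) t) \<noteq> 0"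
    by (simp add: in_keys_iff conic_in_powers_def lookup_sum)
  then obtain i j where ij: "i \<le> 2" "j \<le> 2" "Poly_Mapping.lookup
      (Poly_Mapping.single (Poly_Mapping.single i k + Poly_Mapping.single j k) (q i j)) t \<noteq> 0"
    by (elim sum.not_neutral_contains_not_neutral) auto
  then have t: "t = Poly_Mapping.single i k + Poly_Mapping.single j k"
    by (auto simp: lookup_single when_def split: if_splits)
  have "Poly_Mapping.keys t \<subseteq> {i, j}"
    using Poly_Mapping.keys_add[of "Poly_Mapping.single i k" "Poly_Mapping.single j k"]
    unfolding t by (auto split: if_splits)
  then show "t \<in> monomials 2 (2 * k)"
    using ij(1,2) by (auto simp: monomials_def t total_deg_add)
qed

lemma mult_eval_partial_deriv_conic_in_powers:
  assumes "m \<le> 2" "\<And>i. q i m = q m i"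
  shows "v m * eval_mvpoly (partial_deriv m (conic_in_powers k q)) v =
    2 * of_nat k * v m ^ k * (\<Sum>j\<le>2. q m j * v j ^ k)"
proof -
  define L where "L p = (\<Sum>t\<in>Poly_Mapping.keys p. of_nat (Poly_Mapping.lookup t m) * Poly_Mapping.lookup p t * monomial_value v t)" for p
  have L_add: "L (p + p') = L p + L p'" for p p'
    unfolding L_def by (rule sum_keys_add) (auto simp: algebra_simps)
  have L_sum: "L (\<Sum>x\<in>A. f x) = (\<Sum>x\<in>A. L (f x))" for f and A :: "nat set"
    using sum_comp_morphism[of L f A] by (simp add: L_add comp_def) (simp add: L_def)
  have L_single: "L (Poly_Mapping.single t c) = of_nat (Poly_Mapping.lookup t m) * c * monomial_value v t" for t c
    by (simp add: L_def)
  have "v m * eval_mvpoly (partial_deriv m (conic_in_powers k q)) v =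
      (\<Sum>i\<le>2. \<Sum>j\<le>2. of_nat ((k when i = m) + (k when j = m)) * q i j * (v i ^ k * v j ^ k))"
    unfolding mult_eval_partial_deriv L_def[symmetric] conic_in_powers_def L_sum L_single
    by (simp add: monomial_value_add lookup_add lookup_single)
  also have "\<dots> = (\<Sum>i\<le>2. \<Sum>j\<le>2. (if i = m then of_nat k * q m j * (v m ^ k * v j ^ k) else 0) +
      (if j = m then of_nat k * q i m * (v i ^ k * v m ^ k) else 0))"
    by (intro sum.cong refl) (auto simp: when_def algebra_simps)
  also have "\<dots> = (\<Sum>j\<le>2. of_nat k * q m j * (v m ^ k * v j ^ k)) + (\<Sum>i\<le>2. of_nat k * q i m * (v i ^ k * v m ^ k))"
  proof -
    have "(\<Sum>i\<le>2. \<Sum>j\<le>2. if i = m then of_nat k * q m j * (v m ^ k * v j ^ k) else 0) =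
        (\<Sum>i\<le>2. if i = m then (\<Sum>j\<le>2. of_nat k * q m j * (v m ^ k * v j ^ k)) else 0)"
      by (intro sum.cong) auto
    then show ?thesis
      using assms(1) by (simp add: sum.distrib)
  qed
  also have "\<dots> = 2 * of_nat k * v m ^ k * (\<Sum>j\<le>2. q m j * v j ^ k)"
    unfolding assms(2) by (simp add: sum_distrib_left mult_ac flip: mult_2)
  finally show ?thesis .
qed

text \<open>
  A nonzero diagonal means that the conic avoids the vertices of the coordinate triangle, nonzero
  minors of size 2 that it is not tangent to the sides. This is what makes its preimage smooth.
\<close>

definition principal_minors_nonzero :: "(nat \<Rightarrow> nat \<Rightarrow> 'a::field) \<Rightarrow> bool" where
  "principal_minors_nonzero q \<longleftrightarrow>
     (\<forall>i j. q i j = q j i) \<and> (\<forall>i\<le>2. q i i \<noteq> 0) \<and>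
     (\<forall>i\<le>2. \<forall>j\<le>2. i \<noteq> j \<longrightarrow> (q i j)\<^sup>2 \<noteq> q i i * q j j) \<and>
     q 0 0 * q 1 1 * q 2 2 + 2 * q 0 1 * q 0 2 * q 1 2
       - q 0 0 * (q 1 2)\<^sup>2 - q 1 1 * (q 0 2)\<^sup>2 - q 2 2 * (q 0 1)\<^sup>2 \<noteq> 0"

text \<open>In a triple (i, j, l) the coordinate l is normalised to 1, and i, j supply the affine
  coordinates x, y. Each l occurs once.\<close>

abbreviation charts :: "(nat \<times> nat \<times> nat) set" where
  "charts \<equiv> {(0, 1, 2), (0, 2, 1), (1, 2, 0)}"

lemma sum_atMost_2: "(\<Sum>i\<le>2. f i) = f 0 + f 1 + f (2::nat)"
  by (simp add: numeral_2_eq_2)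

lemma eval_conic_in_powers_eq:
  assumes "\<And>i j. q i j = q j i" "(i, j, l) \<in> charts"
  shows "eval_mvpoly (conic_in_powers k q) v =
    q i i * (v i ^ k)\<^sup>2 + q j j * (v j ^ k)\<^sup>2 + q l l * (v l ^ k)\<^sup>2 +
    2 * q i j * v i ^ k * v j ^ k + 2 * q i l * v i ^ k * v l ^ k + 2 * q j l * v j ^ k * v l ^ k"
proof -
  have q: "q 1 0 = q 0 1" "q 2 0 = q 0 2" "q 2 1 = q 1 2"
    by (rule assms(1))+
  show ?thesis
    unfolding eval_conic_in_powers sum_atMost_2 using assms(2)
    by (auto simp: q q[simplified] power2_eq_square algebra_simps mult_2)
qed

definition chart_poly :: "(nat \<Rightarrow> complex poly poly) \<Rightarrow> complex mvpoly \<Rightarrow> complex poly poly" where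
  "chart_poly e p = (\<Sum>t\<in>Poly_Mapping.keys p.
     [:[:Poly_Mapping.lookup p t:]:] * (\<Prod>i\<in>Poly_Mapping.keys t. e i ^ Poly_Mapping.lookup t i))"

lemma poly_chart_poly:
  "poly (poly (chart_poly e p) [:y:]) x = eval_mvpoly p (\<lambda>i. poly (poly (e i) [:y:]) x)"
  by (simp add: chart_poly_def eval_mvpoly_def poly_sum poly_prod)

lemma coord_scale_in_affine_cone:
  assumes "v \<in> affine_cone N F" "c \<noteq> 0" "homogeneous_set N F"
  shows "coord_scale c v \<in> affine_cone N F"
proof -
  have "eval_mvpoly f (coord_scale c v) = 0" if f: "f \<in> F" for f
  proof -
    obtain m where "f \<in> forms N m"
      using assms(3) f by (auto simp: homogeneous_set_def)
    then show ?thesis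
      using assms(1) f by (simp add: eval_form_scale affine_cone_def)
  qed
  then show ?thesis
    using assms(1,2) by (auto simp: affine_cone_def coord_scale_def fun_eq_iff)
qed

text \<open>Dehomogenised, the two forms become the P and Q of the affine irreducibility result, so
  one of them vanishes on the whole chart. Two points in place of two universal statements are what
  the projective argument needs.\<close>

lemma conic_in_powers_chart:
  fixes q :: "nat \<Rightarrow> nat \<Rightarrow> complex"
  assumes k: "k \<ge> 1" and q: "principal_minors_nonzero q"
    and ijl: "(i, j, l) \<in> charts"
  defines "X \<equiv> affine_cone 2 {conic_in_powers k q}"
  assumes v: "v \<in> X" "v l \<noteq> 0" and w: "w \<in> X" "w l \<noteq> 0"
    and forms: "f \<in> forms 2 m" "h \<in> forms 2 n"
    and vanish: "\<And>u. u \<in> X \<Longrightarrow> eval_mvpoly f u = 0 \<or> eval_mvpoly h u = 0"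
  shows "eval_mvpoly f v = 0 \<or> eval_mvpoly h w = 0"
proof -
  define U where "U x y = (\<lambda>n. if n = i then x else if n = j then y else if n = l then 1 else 0)" for x y :: complex
  define e :: "nat \<Rightarrow> complex poly poly"
    where "e = (\<lambda>n. if n = i then [:[:0, 1:]:] else if n = j then [:0, 1:] else if n = l then 1 else 0)"
  have dist: "i \<noteq> j" "i \<noteq> l" "j \<noteq> l" "i \<le> 2" "j \<le> 2" "l \<le> 2"
    using ijl by auto
  have third: "n = i \<or> n = j \<or> n = l \<or> n > 2" for n
    using ijl by auto
  have eval_chart: "poly (poly (chart_poly e p) [:y:]) x = eval_mvpoly p (U x y)" for p x y
    unfolding poly_chart_poly by (rule arg_cong[where f = "eval_mvpoly p"]) (auto simp: e_def U_def fun_eq_iff)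
  define F where "F x y = q i i * (x ^ k)\<^sup>2 + q j j * (y ^ k)\<^sup>2 + q l l + 2 * q i j * x ^ k * y ^ k +
    2 * q i l * x ^ k + 2 * q j l * y ^ k" for x y
  have sym: "q r s = q s r" for r s
    using q by (simp add: principal_minors_nonzero_def)
  have "eval_mvpoly (conic_in_powers k q) (U x y) = F x y" for x y
    unfolding eval_conic_in_powers_eq[OF sym ijl] F_def U_def using dist by simp
  moreover have "U x y l = 1" "\<forall>n>2. U x y n = 0" for x y
    using dist by (auto simp: U_def)
  ultimately have U: "U x y \<in> X \<longleftrightarrow> F x y = 0" for x y
    unfolding X_def affine_cone_def by (auto simp: fun_eq_iff) (metis one_neq_zero)
  have det: "q i i * q j j * q l l + 2 * q i j * q i l * q j l - q i i * (q j l)\<^sup>2 - q j j * (q i l)\<^sup>2 - q l l * (q i j)\<^sup>2 \<noteq> 0"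
    using q ijl sym[of 1 0] sym[of 2 0] sym[of 2 1] unfolding principal_minors_nonzero_def
    by (auto simp: algebra_simps)
  have minors: "q i i \<noteq> 0" "q j j \<noteq> 0" "q l l \<noteq> 0" "(q i j)\<^sup>2 \<noteq> q i i * q j j" "(q i l)\<^sup>2 \<noteq> q i i * q l l"
    "(q j l)\<^sup>2 \<noteq> q j j * q l l"
    using q dist unfolding principal_minors_nonzero_def by auto
  have "(\<forall>x y. F x y = 0 \<longrightarrow> eval_mvpoly f (U x y) = 0) \<or> (\<forall>x y. F x y = 0 \<longrightarrow> eval_mvpoly h (U x y) = 0)"
    unfolding eval_chart[symmetric] F_def
  proof (rule conic_in_powers_irreducible[OF k minors det], fold F_def)
    fix x y assume "F x y = 0"
    then show "poly (poly (chart_poly e f) [:y:]) x = 0 \<or> poly (poly (chart_poly e h) [:y:]) x = 0"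
      unfolding eval_chart by (intro vanish) (simp only: U)
  qed
  moreover
  have "\<exists>x y. F x y = 0 \<and> coord_scale (inverse (u l)) u = U x y" if u: "u \<in> X" "u l \<noteq> 0" for u
  proof -
    have "homogeneous_set 2 {conic_in_powers k q}"
      using conic_in_powers_in_forms by (auto simp: homogeneous_set_def)
    then have "coord_scale (inverse (u l)) u \<in> X"
      using u unfolding X_def by (intro coord_scale_in_affine_cone) auto
    moreover have "coord_scale (inverse (u l)) u n = U (u i / u l) (u j / u l) n" for n
    proof -
      have "u n = 0" if "n > 2"
        using u(1) that by (simp add: X_def affine_cone_def)
      then show ?thesis
        using third[of n] dist u(2) by (auto simp: U_def coord_scale_def divide_inverse)
    qed
    then have "coord_scale (inverse (u l)) u = U (u i / u l) (u j / u l)"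
      by (rule ext)
    ultimately have "F (u i / u l) (u j / u l) = 0"
      using U[of "u i / u l" "u j / u l"] by simp
    with \<open>coord_scale (inverse (u l)) u = U (u i / u l) (u j / u l)\<close> show ?thesis
      by blast
  qed
  from this[OF v] this[OF w] obtain xv yv xw yw where
    "F xv yv = 0" "coord_scale (inverse (v l)) v = U xv yv"
    "F xw yw = 0" "coord_scale (inverse (w l)) w = U xw yw"
    by blast
  ultimately have "eval_mvpoly f (coord_scale (inverse (v l)) v) = 0 \<or> eval_mvpoly h (coord_scale (inverse (w l)) w) = 0"
    by auto
  then show ?thesis
    using v(2) w(2) by (simp add: eval_form_scale[OF forms(1)] eval_form_scale[OF forms(2)])
qed

lemma not_mem_proj_zerosE:
  assumes "v \<in> affine_cone N F" "proj_point v \<notin> proj_zeros N G" "homogeneous_set N G"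
  obtains g m where "g \<in> G" "g \<in> forms N m" "eval_mvpoly g v \<noteq> 0"
proof -
  have "v \<notin> affine_cone N G"
    using assms(2) by (auto simp: proj_zeros_def)
  then obtain g where "g \<in> G" "eval_mvpoly g v \<noteq> 0"
    using assms(1) by (auto simp: affine_cone_def)
  then show ?thesis
    using that assms(3) by (auto simp: homogeneous_set_def)
qed

lemma eval_eq_0_if_mem_proj_zeros:
  assumes "proj_point v \<in> proj_zeros N G" "g \<in> G" "g \<in> forms N m"
  shows "eval_mvpoly g v = 0"
proof -
  obtain w where w: "w \<in> affine_cone N G" "proj_point v = proj_point w"
    using assms(1) by (auto simp: proj_zeros_def)
  have "v \<in> proj_point v"
    by (auto simp: proj_point_def coord_scale_def intro!: exI[of _ 1])
  then obtain c where "v = coord_scale c w"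
    unfolding w(2) by (auto simp: proj_point_def)
  then show ?thesis
    using w(1) assms(2,3) by (simp add: eval_form_scale affine_cone_def)
qed

text \<open>A point of the curve has at most one zero coordinate, because the conic avoids the
  vertices of the triangle. So a point outside the zeros of \<open>G\<close> and one outside the
  zeros of \<open>H\<close> share a nonzero coordinate, and the corresponding chart gives a
  contradiction.\<close>

lemma zariski_irreducible_conic_in_powers:
  fixes q :: "nat \<Rightarrow> nat \<Rightarrow> complex"
  assumes k: "k \<ge> 1" and q: "principal_minors_nonzero q"
  shows "zariski_irreducible 2 (proj_zeros 2 {conic_in_powers k q})"
  unfolding zariski_irreducible_def
proof (intro conjI allI impI)
  define X where "X = affine_cone 2 {conic_in_powers k q}"
  have Z: "proj_zeros 2 {conic_in_powers k q} = proj_point ` X"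
    by (simp add: X_def proj_zeros_def)
  have sym: "q r s = q s r" for r s
    using q by (simp add: principal_minors_nonzero_def)
  have diag: "q i i \<noteq> 0" if "i \<le> 2" for i
    using q that by (simp add: principal_minors_nonzero_def)
  \<comment> \<open>A point of the form (0 : y : 1) shows that the curve is nonempty.\<close>
  obtain y where y: "poly (monom (q 1 1) (2 * k) + monom (2 * q 1 2) k + [:q 2 2:]) y = 0"
    using simple_root_exists[of k "q 1 1" "q 2 2" "q 1 2"] k q
    by (auto simp: principal_minors_nonzero_def)
  have pow: "y ^ (2 * k) = (y ^ k)\<^sup>2"
    by (simp add: mult.commute flip: power_mult)
  define u where "u = (\<lambda>n::nat. if n = 1 then y else if n = 2 then 1 else 0)"
  have "eval_mvpoly (conic_in_powers k q) u = q 1 1 * (y ^ k)\<^sup>2 + 2 * q 1 2 * y ^ k + q 2 2"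
    using k by (simp add: u_def eval_conic_in_powers_eq[OF sym, of 0 1 2] power_0_left)
  also have "\<dots> = 0"
    using y by (simp add: poly_monom pow)
  finally have "eval_mvpoly (conic_in_powers k q) u = 0" .
  moreover have "u 2 = 1" "\<forall>n>2. u n = 0"
    by (simp_all add: u_def)
  ultimately have "u \<in> X"
    unfolding X_def affine_cone_def by fastforce
  then show "proj_zeros 2 {conic_in_powers k q} \<noteq> {}"
    unfolding Z by blast
  fix G H :: "complex mvpoly set"
  assume GH: "homogeneous_set 2 G \<and> homogeneous_set 2 H \<and>
    proj_zeros 2 {conic_in_powers k q} \<subseteq> proj_zeros 2 G \<union> proj_zeros 2 H"
  show "proj_zeros 2 {conic_in_powers k q} \<subseteq> proj_zeros 2 G \<or> proj_zeros 2 {conic_in_powers k q} \<subseteq> proj_zeros 2 H"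
  proof (rule ccontr)
    assume "\<not> ?thesis"
    then obtain v w where vw: "v \<in> X" "w \<in> X" "proj_point v \<notin> proj_zeros 2 G" "proj_point w \<notin> proj_zeros 2 H"
      unfolding Z by auto
    obtain g m where g: "g \<in> G" "g \<in> forms 2 m" "eval_mvpoly g v \<noteq> 0"
      using not_mem_proj_zerosE[OF vw(1)[unfolded X_def] vw(3)] GH by blast
    obtain h n where h: "h \<in> H" "h \<in> forms 2 n" "eval_mvpoly h w \<noteq> 0"
      using not_mem_proj_zerosE[OF vw(2)[unfolded X_def] vw(4)] GH by blast
    have vanish: "eval_mvpoly g u = 0 \<or> eval_mvpoly h u = 0" if "u \<in> X" for u
      using GH that eval_eq_0_if_mem_proj_zeros[OF _ g(1,2)] eval_eq_0_if_mem_proj_zeros[OF _ h(1,2)]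
      unfolding Z by blast
    have two: "u i \<noteq> 0 \<or> u j \<noteq> 0" if "u \<in> X" "(i, j, l) \<in> charts" for u i j l
    proof (rule ccontr)
      assume "\<not> ?thesis"
      then have uij: "u i = 0" "u j = 0"
        by auto
      moreover have "eval_mvpoly (conic_in_powers k q) u = 0"
        using that(1) by (simp add: X_def affine_cone_def)
      ultimately have "q l l * (u l ^ k)\<^sup>2 = 0"
        using k by (simp add: eval_conic_in_powers_eq[OF sym that(2)] power_0_left)
      then have "u l = 0"
        using diag[of l] that(2) by auto
      moreover have "u n = 0" if "n > 2" for n
        using \<open>u \<in> X\<close> that by (simp add: X_def affine_cone_def)
      moreover have "n = i \<or> n = j \<or> n = l \<or> n > 2" for n
        using that(2) by auto
      ultimately have "u n = 0" for n
        using uij by metis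
      then show False
        using \<open>u \<in> X\<close> by (auto simp: X_def affine_cone_def fun_eq_iff)
    qed
    have chart: "v l = 0 \<or> w l = 0" if "(i, j, l) \<in> charts" for i j l
      using conic_in_powers_chart[OF k q that, of v w g m h n] vw(1,2) g(2,3) h(2,3) vanish
      unfolding X_def by blast
    have "v 2 = 0 \<or> w 2 = 0" "v 1 = 0 \<or> w 1 = 0" "v 0 = 0 \<or> w 0 = 0"
      using chart[of 0 1 2] chart[of 0 2 1] chart[of 1 2 0] by simp_all
    moreover have "u 0 \<noteq> 0 \<or> u 1 \<noteq> 0" "u 0 \<noteq> 0 \<or> u 2 \<noteq> 0" "u 1 \<noteq> 0 \<or> u 2 \<noteq> 0" if "u \<in> X" for u
      using two[OF that, of 0 1 2] two[OF that, of 0 2 1] two[OF that, of 1 2 0] by simp_all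
    ultimately show False
      using vw(1,2) by metis
  qed
qed

section \<open>Smoothness and genus of the preimage of a conic\<close>

interpretation coords: vector_space "coord_scale :: 'a::field \<Rightarrow> _"
  by (rule vector_space_coord_scale)

text \<open>With X_m = v_m^k, a vanishing gradient gives X_m = 0 or (q X)_m = 0 for each m.
  Restricted to the indices with X_m \<noteq> 0, the vector X is then in the kernel of a principal
  submatrix of q of size 1, 2 or 3, and all these are invertible.\<close>

lemma gradient_conic_in_powers_nonzero:
  fixes q :: "nat \<Rightarrow> nat \<Rightarrow> 'a::field_char_0"
  assumes k: "k \<ge> 1" and q: "principal_minors_nonzero q" and v: "\<forall>n>2. v n = 0" "v \<noteq> (\<lambda>_. 0)"
  shows "gradient 2 (conic_in_powers k q) v \<noteq> (\<lambda>_. 0)"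
proof
  assume zero: "gradient 2 (conic_in_powers k q) v = (\<lambda>_. 0)"
  have sym: "q r s = q s r" for r s
    using q by (simp add: principal_minors_nonzero_def)
  define X where "X n = v n ^ k" for n
  have X: "X m = 0 \<or> q m 0 * X 0 + q m 1 * X 1 + q m 2 * X 2 = 0" if "m \<le> 2" for m
  proof -
    have "eval_mvpoly (partial_deriv m (conic_in_powers k q)) v = 0"
      using fun_cong[OF zero, of m] that by (simp add: gradient_def)
    then show ?thesis
      using mult_eval_partial_deriv_conic_in_powers[where q = q and v = v and k = k, OF that sym] k
      by (simp add: X_def sum_atMost_2)
  qed
  have nonzero: "X 0 \<noteq> 0 \<or> X 1 \<noteq> 0 \<or> X 2 \<noteq> 0"
  proof (rule ccontr)
    assume "\<not> ?thesis"
    then have "v 0 = 0" "v 1 = 0" "v 2 = 0"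
      using k by (simp_all add: X_def)
    moreover have "n = 0 \<or> n = 1 \<or> n = 2 \<or> n > 2" for n :: nat
      by linarith
    ultimately have "v n = 0" for n
      using v(1) by metis
    then show False
      using v(2) by blast
  qed
  have diag: "q 0 0 \<noteq> 0" "q 1 1 \<noteq> 0" "q 2 2 \<noteq> 0"
    using q unfolding principal_minors_nonzero_def by auto
  have pair: "x = 0 \<and> y = 0" if "q i i * x + q i j * y = 0" "q i j * x + q j j * y = 0" "(i, j, l) \<in> charts" for i j l x y
  proof -
    have "(q i j)\<^sup>2 - q i i * q j j \<noteq> 0"
      using q that(3) unfolding principal_minors_nonzero_def by auto
    moreover have "((q i j)\<^sup>2 - q i i * q j j) * x = q i j * (q i j * x + q j j * y) - q j j * (q i i * x + q i j * y)"
      by (simp add: power2_eq_square algebra_simps)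
    moreover have "((q i j)\<^sup>2 - q i i * q j j) * y = q i j * (q i i * x + q i j * y) - q i i * (q i j * x + q j j * y)"
      by (simp add: power2_eq_square algebra_simps)
    ultimately show ?thesis
      unfolding that(1,2) by simp
  qed
  have triple: False if E: "q 0 0 * X 0 + q 0 1 * X 1 + q 0 2 * X 2 = 0" "q 0 1 * X 0 + q 1 1 * X 1 + q 1 2 * X 2 = 0"
      "q 0 2 * X 0 + q 1 2 * X 1 + q 2 2 * X 2 = 0" "X 0 \<noteq> 0"
  proof -
    have "(q 0 0 * q 1 1 * q 2 2 + 2 * q 0 1 * q 0 2 * q 1 2
        - q 0 0 * (q 1 2)\<^sup>2 - q 1 1 * (q 0 2)\<^sup>2 - q 2 2 * (q 0 1)\<^sup>2) * X 0 =
        (q 1 1 * q 2 2 - (q 1 2)\<^sup>2) * (q 0 0 * X 0 + q 0 1 * X 1 + q 0 2 * X 2) +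
        (q 1 2 * q 0 2 - q 0 1 * q 2 2) * (q 0 1 * X 0 + q 1 1 * X 1 + q 1 2 * X 2) +
        (q 0 1 * q 1 2 - q 1 1 * q 0 2) * (q 0 2 * X 0 + q 1 2 * X 1 + q 2 2 * X 2)"
      by (simp add: power2_eq_square algebra_simps)
    then show False
      unfolding E(1-3) using E(4) q by (simp add: principal_minors_nonzero_def)
  qed
  have X0: "X 0 = 0 \<or> q 0 0 * X 0 + q 0 1 * X 1 + q 0 2 * X 2 = 0"
    using X[of 0] by simp
  have X1: "X 1 = 0 \<or> q 0 1 * X 0 + q 1 1 * X 1 + q 1 2 * X 2 = 0"
    using X[of 1] unfolding sym[of 1 0] by simp
  have X2: "X 2 = 0 \<or> q 0 2 * X 0 + q 1 2 * X 1 + q 2 2 * X 2 = 0"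
    using X[of 2] unfolding sym[of 2 0] sym[of 2 1] by simp
  consider "X 0 = 0" "X 1 = 0" | "X 0 = 0" "X 2 = 0" | "X 1 = 0" "X 2 = 0"
    | "X 0 = 0" "X 1 \<noteq> 0" "X 2 \<noteq> 0" | "X 0 \<noteq> 0" "X 1 = 0" "X 2 \<noteq> 0" | "X 0 \<noteq> 0" "X 1 \<noteq> 0" "X 2 = 0"
    | "X 0 \<noteq> 0" "X 1 \<noteq> 0" "X 2 \<noteq> 0"
    by blast
  then show False
  proof cases
    case 1
    then show ?thesis using nonzero X2 diag by simp
  next
    case 2
    then show ?thesis using nonzero X1 diag by simp
  next
    case 3
    then show ?thesis using nonzero X0 diag by simp
  next
    case 4
    then show ?thesis using X1 X2 pair[of 1 "X 1" 2 "X 2" 0] by simp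
  next
    case 5
    then show ?thesis using X0 X2 pair[of 0 "X 0" 2 "X 2" 1] by simp
  next
    case 6
    then show ?thesis using X0 X1 pair[of 0 "X 0" 1 "X 1" 2] by simp
  next
    case 7
    then show ?thesis using X0 X1 X2 triple by blast
  qed
qed

lemma jacobian_rank_singleton:
  assumes "gradient N f v \<noteq> (\<lambda>_. 0)"
  shows "jacobian_rank N {f} v = 1"
proof -
  have "coords.independent {gradient N f v}"
    using assms by (simp add: coords.dependent_single zero_fun_def)
  then show ?thesis
    by (simp add: jacobian_rank_def coords.dim_eq_card_independent)
qed

lemma smooth_projective_curve_conic_in_powers:
  assumes k: "k \<ge> 2" and q: "principal_minors_nonzero (q :: nat \<Rightarrow> nat \<Rightarrow> rat)"
  shows "smooth_projective_curve 2 {conic_in_powers k q}"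
    and "has_arithmetic_genus 2 {conic_in_powers k q} (int ((2 * k - 1) * (k - 1)))"
proof -
  define f where "f = conic_in_powers k q"
  define P :: "rat poly" where "P = [:of_nat (2 * k) * (3 - of_nat (2 * k)) / 2, of_nat (2 * k):]"
  have "eval_mvpoly f (\<lambda>n. if n = 0 then 1 else 0) = q 0 0"
    unfolding f_def eval_conic_in_powers sum_atMost_2 using k by (simp add: power_0_left)
  moreover have "q 0 0 \<noteq> 0"
    using q by (simp add: principal_minors_nonzero_def)
  ultimately have "f \<noteq> 0"
    by auto
  moreover have "f \<in> forms 2 (2 * k)"
    unfolding f_def by (rule conic_in_powers_in_forms)
  ultimately have P: "is_hilbert_polynomial 2 {f} P"
    unfolding P_def by (intro is_hilbert_polynomial_plane_curve)
  have "of_nat (2 * k) \<noteq> (0 :: rat)"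
    using k by simp
  then have "P \<noteq> 0" "degree P = 1"
    unfolding P_def by (simp_all only: pCons_eq_0_iff degree_pCons_eq_if simp_thms if_False) simp_all
  have qc: "principal_minors_nonzero (\<lambda>i j. of_rat (q i j) :: complex)"
    unfolding principal_minors_nonzero_def
  proof (intro conjI allI impI)
    fix i j :: nat
    show "of_rat (q i j) = (of_rat (q j i) :: complex)"
      using q by (simp add: principal_minors_nonzero_def)
    show "(of_rat (q i i) :: complex) \<noteq> 0" if "i \<le> 2"
      using q that by (simp add: principal_minors_nonzero_def)
    show "(of_rat (q i j) :: complex)\<^sup>2 \<noteq> of_rat (q i i) * of_rat (q j j)" if "i \<le> 2" "j \<le> 2" "i \<noteq> j"
      unfolding of_rat_mult[symmetric] of_rat_power[symmetric] of_rat_eq_iff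
      using q that by (simp add: principal_minors_nonzero_def)
  next
    let ?d = "q 0 0 * q 1 1 * q 2 2 + 2 * q 0 1 * q 0 2 * q 1 2
       - q 0 0 * (q 1 2)\<^sup>2 - q 1 1 * (q 0 2)\<^sup>2 - q 2 2 * (q 0 1)\<^sup>2"
    let ?r = "\<lambda>i j. of_rat (q i j) :: complex"
    have "?r 0 0 * ?r 1 1 * ?r 2 2 + 2 * ?r 0 1 * ?r 0 2 * ?r 1 2
       - ?r 0 0 * (?r 1 2)\<^sup>2 - ?r 1 1 * (?r 0 2)\<^sup>2 - ?r 2 2 * (?r 0 1)\<^sup>2 = of_rat ?d"
      by (simp add: of_rat_add of_rat_diff of_rat_mult of_rat_power)
    moreover have "?d \<noteq> 0"
      using q[unfolded principal_minors_nonzero_def, THEN conjunct2, THEN conjunct2, THEN conjunct2] .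
    ultimately show "?r 0 0 * ?r 1 1 * ?r 2 2 + 2 * ?r 0 1 * ?r 0 2 * ?r 1 2
       - ?r 0 0 * (?r 1 2)\<^sup>2 - ?r 1 1 * (?r 0 2)\<^sup>2 - ?r 2 2 * (?r 0 1)\<^sup>2 \<noteq> 0"
      by (simp only: of_rat_eq_0_iff not_False_eq_True)
  qed
  have cf: "complexify ` {f} = {conic_in_powers k (\<lambda>i j. of_rat (q i j))}"
    by (simp add: f_def complexify_conic_in_powers)
  have "homogeneous_set 2 {f}"
    using conic_in_powers_in_forms by (auto simp: homogeneous_set_def f_def)
  moreover have "geometrically_irreducible 2 {f}"
    unfolding geometrically_irreducible_def complex_points_def cf
    using k qc by (intro zariski_irreducible_conic_in_powers) auto
  moreover have "has_dimension 2 {f} 1"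
    unfolding has_dimension_def using P \<open>P \<noteq> 0\<close> \<open>degree P = 1\<close> by blast
  moreover have "smooth_of_dim 2 {f} 1"
    unfolding smooth_of_dim_def cf
  proof
    fix v :: "nat \<Rightarrow> complex"
    assume "v \<in> affine_cone 2 {conic_in_powers k (\<lambda>i j. of_rat (q i j))}"
    then have "gradient 2 (conic_in_powers k (\<lambda>i j. of_rat (q i j))) v \<noteq> (\<lambda>_. 0)"
      using k qc by (intro gradient_conic_in_powers_nonzero) (auto simp: affine_cone_def)
    then show "jacobian_rank 2 {conic_in_powers k (\<lambda>i j. of_rat (q i j))} v + 1 = 2"
      by (simp add: jacobian_rank_singleton)
  qed
  ultimately show "smooth_projective_curve 2 {conic_in_powers k q}"
    by (simp add: smooth_projective_curve_def f_def)
  obtain j where j: "k = j + 2"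
    using k by (metis add.commute le_Suc_ex)
  have "rat_of_int (int ((2 * k - 1) * (k - 1))) = (- 1) ^ degree P * (poly P 0 - 1)"
    unfolding \<open>degree P = 1\<close> by (simp add: P_def j field_simps)
  then show "has_arithmetic_genus 2 {conic_in_powers k q} (int ((2 * k - 1) * (k - 1)))"
    unfolding has_arithmetic_genus_def using P \<open>P \<noteq> 0\<close> f_def by blast
qed

section \<open>Small exponents\<close>

text \<open>The cross product of two vectors in dimension 3, with indices in cyclic order.\<close>

definition cof :: "(nat \<Rightarrow> 'a::comm_ring_1) \<Rightarrow> (nat \<Rightarrow> 'a) \<Rightarrow> nat \<Rightarrow> 'a" where
  "cof f g i = f ((i + 1) mod 3) * g ((i + 2) mod 3) - f ((i + 2) mod 3) * g ((i + 1) mod 3)"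

text \<open>The determinant of the rows (1, x_i + y_i, x_i y_i) after subtracting row 0. Over a
  field it vanishes exactly when the quadratics (T - x_i) (T - y_i) are linearly dependent.\<close>

definition quadratics_det :: "(nat \<Rightarrow> 'a::comm_ring_1) \<Rightarrow> (nat \<Rightarrow> 'a) \<Rightarrow> 'a" where
  "quadratics_det x y =
     (x 1 + y 1 - (x 0 + y 0)) * (x 2 * y 2 - x 0 * y 0) - (x 2 + y 2 - (x 0 + y 0)) * (x 1 * y 1 - x 0 * y 0)"

text \<open>
  The columns of the adjugate of the matrix with rows \<open>(1, x\<^sub>i + y\<^sub>i, x\<^sub>i y\<^sub>i)\<close> are the vectors
  \<open>(\<alpha>\<^sub>i, \<beta>\<^sub>i, \<gamma>\<^sub>i)\<close> below. It maps the point with coordinates \<open>(n + x\<^sub>i b) (n + y\<^sub>i b)\<close> to a multiple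
  of \<open>(n\<^sup>2, n b, b\<^sup>2)\<close>, which lies on the conic \<open>2 (Y\<^sup>2 - X Z) = 0\<close>.
\<close>

definition conic_matrix :: "(nat \<Rightarrow> 'a::comm_ring_1) \<Rightarrow> (nat \<Rightarrow> 'a) \<Rightarrow> nat \<Rightarrow> nat \<Rightarrow> 'a" where
  "conic_matrix x y i j =
     (let s = \<lambda>i. x i + y i; p = \<lambda>i. x i * y i;
          \<alpha> = cof s p; \<beta> = (\<lambda>i. - cof (\<lambda>_. 1) p i); \<gamma> = cof (\<lambda>_. 1) s
      in 2 * \<beta> i * \<beta> j - \<alpha> i * \<gamma> j - \<alpha> j * \<gamma> i)"

lemma cof_simps:
  "cof f g 0 = f 1 * g 2 - f 2 * g 1" "cof f g 1 = f 2 * g 0 - f 0 * g 2" "cof f g 2 = f 0 * g 1 - f 1 * g 0"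
  by (simp_all add: cof_def) (simp_all add: numeral_2_eq_2)

text \<open>Twice the resultant of the quadratics with roots x j, y j and x l, y l: the conic passes
  through vertex i if these have a common root.\<close>

lemma conic_matrix_diag:
  fixes x y :: "nat \<Rightarrow> 'a::comm_ring_1"
  assumes "(i, j, l) \<in> {(0, 1, 2), (1, 2, 0), (2, 0, 1)}"
  shows "conic_matrix x y i i = 2 * ((x j - x l) * (x j - y l) * (y j - x l) * (y j - y l))"
  using assms unfolding conic_matrix_def Let_def
  by (auto simp only: insert_iff empty_iff prod.inject cof_simps) (simp_all add: algebra_simps)

text \<open>Up to a factor 4 this minor is the discriminant of the conic restricted to the side X_l
  = 0. The side is met where (n + x l * b) (n + y l * b) = 0, which explains the factor (x l - y
  l)^2.\<close>

lemma conic_matrix_minor: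
  fixes x y :: "nat \<Rightarrow> 'a::comm_ring_1"
  assumes "(i, j, l) \<in> {(0, 1, 2), (1, 2, 0), (2, 0, 1)}"
  shows "(conic_matrix x y i j)\<^sup>2 - conic_matrix x y i i * conic_matrix x y j j = (quadratics_det x y * (x l - y l))\<^sup>2"
proof -
  define s p where "s = (\<lambda>i. x i + y i)" and "p = (\<lambda>i. x i * y i)"
  define \<alpha> \<beta> \<gamma> where "\<alpha> = cof s p" and "\<beta> = (\<lambda>i. - cof (\<lambda>_. 1) p i)" and "\<gamma> = cof (\<lambda>_. 1) s"
  define \<Delta> where "\<Delta> = (s 1 - s 0) * (p 2 - p 0) - (s 2 - s 0) * (p 1 - p 0)"
  have q: "conic_matrix x y i j = 2 * \<beta> i * \<beta> j - \<alpha> i * \<gamma> j - \<alpha> j * \<gamma> i" for i j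
    by (simp add: conic_matrix_def Let_def \<alpha>_def \<beta>_def \<gamma>_def s_def p_def)
  \<comment> \<open>Cross products of columns of the adjugate are \<Delta> times the rows of the
    original matrix: for size 3 the adjugate of the adjugate is \<Delta> times the matrix.\<close>
  have cross: "\<beta> i * \<gamma> j - \<gamma> i * \<beta> j = \<Delta>" "\<gamma> i * \<alpha> j - \<alpha> i * \<gamma> j = \<Delta> * s l"
    "\<alpha> i * \<beta> j - \<beta> i * \<alpha> j = \<Delta> * p l"
    using assms unfolding \<alpha>_def \<beta>_def \<gamma>_def \<Delta>_def
    by (auto simp only: insert_iff empty_iff prod.inject cof_simps) (simp_all add: algebra_simps)
  have "(2 * \<beta> i * \<beta> j - \<alpha> i * \<gamma> j - \<alpha> j * \<gamma> i)\<^sup>2 -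
      (2 * \<beta> i * \<beta> i - \<alpha> i * \<gamma> i - \<alpha> i * \<gamma> i) * (2 * \<beta> j * \<beta> j - \<alpha> j * \<gamma> j - \<alpha> j * \<gamma> j) =
      (\<gamma> i * \<alpha> j - \<alpha> i * \<gamma> j)\<^sup>2 - 4 * (\<beta> i * \<gamma> j - \<gamma> i * \<beta> j) * (\<alpha> i * \<beta> j - \<beta> i * \<alpha> j)"
    by (simp add: power2_eq_square algebra_simps)
  also have "\<dots> = \<Delta>\<^sup>2 * ((s l)\<^sup>2 - 4 * p l)"
    unfolding cross by (simp add: power2_eq_square algebra_simps)
  also have "(s l)\<^sup>2 - 4 * p l = (x l - y l)\<^sup>2"
    by (simp add: s_def p_def power2_eq_square algebra_simps)
  also have "\<Delta> = quadratics_det x y"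
    by (simp add: \<Delta>_def s_def p_def quadratics_det_def)
  finally show ?thesis
    unfolding q by (simp add: power_mult_distrib)
qed

text \<open>The form 2 (Y^2 - X Z) has determinant -2, and it is transformed by the adjugate, whose
  determinant \<open>C\<close> is \<Delta>^2.\<close>

lemma conic_matrix_det:
  fixes x y :: "nat \<Rightarrow> 'a::comm_ring_1"
  defines "q \<equiv> conic_matrix x y"
  shows "q 0 0 * q 1 1 * q 2 2 + 2 * q 0 1 * q 0 2 * q 1 2
       - q 0 0 * (q 1 2)\<^sup>2 - q 1 1 * (q 0 2)\<^sup>2 - q 2 2 * (q 0 1)\<^sup>2 = - 2 * quadratics_det x y ^ 4"
proof -
  define s p where "s = (\<lambda>i. x i + y i)" and "p = (\<lambda>i. x i * y i)"
  define \<alpha> \<beta> \<gamma> where "\<alpha> = cof s p" and "\<beta> = (\<lambda>i. - cof (\<lambda>_. 1) p i)" and "\<gamma> = cof (\<lambda>_. 1) s"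
  define \<Delta> where "\<Delta> = (s 1 - s 0) * (p 2 - p 0) - (s 2 - s 0) * (p 1 - p 0)"
  have q: "q i j = 2 * \<beta> i * \<beta> j - \<alpha> i * \<gamma> j - \<alpha> j * \<gamma> i" for i j
    by (simp add: q_def conic_matrix_def Let_def \<alpha>_def \<beta>_def \<gamma>_def s_def p_def)
  define C where "C = \<alpha> 0 * (\<beta> 1 * \<gamma> 2 - \<gamma> 1 * \<beta> 2) - \<alpha> 1 * (\<beta> 0 * \<gamma> 2 - \<gamma> 0 * \<beta> 2) + \<alpha> 2 * (\<beta> 0 * \<gamma> 1 - \<gamma> 0 * \<beta> 1)"
  have "q 0 0 * q 1 1 * q 2 2 + 2 * q 0 1 * q 0 2 * q 1 2
       - q 0 0 * (q 1 2)\<^sup>2 - q 1 1 * (q 0 2)\<^sup>2 - q 2 2 * (q 0 1)\<^sup>2 = - 2 * C\<^sup>2"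
    unfolding q C_def by (simp add: power2_eq_square algebra_simps)
  also have "C = \<Delta>\<^sup>2"
    unfolding C_def \<alpha>_def \<beta>_def \<gamma>_def \<Delta>_def cof_simps by (simp add: power2_eq_square algebra_simps)
  also have "\<Delta> = quadratics_det x y"
    by (simp add: \<Delta>_def s_def p_def quadratics_det_def)
  finally show ?thesis
    by (simp flip: power_mult)
qed

lemma conic_matrix_sym: "conic_matrix x y i j = conic_matrix x y j i"
  by (simp add: conic_matrix_def Let_def algebra_simps)

lemma principal_minors_conic_matrix:
  fixes x y :: "nat \<Rightarrow> 'a::field_char_0"
  assumes det: "quadratics_det x y \<noteq> 0"
    and dist: "\<And>i j. i \<le> 2 \<Longrightarrow> j \<le> 2 \<Longrightarrow> x i \<noteq> y j"
      "\<And>i j. i \<le> 2 \<Longrightarrow> j \<le> 2 \<Longrightarrow> i \<noteq> j \<Longrightarrow> x i \<noteq> x j \<and> y i \<noteq> y j"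
  shows "principal_minors_nonzero (conic_matrix x y)"
  unfolding principal_minors_nonzero_def
proof (intro conjI allI impI)
  fix i j :: nat
  show "conic_matrix x y i j = conic_matrix x y j i"
    by (rule conic_matrix_sym)
  show "conic_matrix x y i i \<noteq> 0" if "i \<le> 2"
  proof -
    define j l where "j = (if i = 0 then 1 else if i = 1 then 2 else 0 :: nat)"
      and "l = (if i = 0 then 2 else if i = 1 then 0 else 1 :: nat)"
    have "i = 0 \<or> i = 1 \<or> i = 2"
      using that by linarith
    then have ijl: "(i, j, l) \<in> {(0, 1, 2), (1, 2, 0), (2, 0, 1)}"
      by (auto simp: j_def l_def)
    then have "j \<le> 2" "l \<le> 2" "j \<noteq> l"
      by auto
    then show ?thesis
      unfolding conic_matrix_diag[OF ijl] using dist(1)[of j l] dist(1)[of l j] dist(2)[of j l] by auto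
  qed
  show "(conic_matrix x y i j)\<^sup>2 \<noteq> conic_matrix x y i i * conic_matrix x y j j" if "i \<le> 2" "j \<le> 2" "i \<noteq> j"
  proof -
    have minor: "(conic_matrix x y i j)\<^sup>2 \<noteq> conic_matrix x y i i * conic_matrix x y j j"
      if "(i, j, l) \<in> {(0, 1, 2), (1, 2, 0), (2, 0, 1)}" for i j l :: nat
    proof -
      have "quadratics_det x y * (x l - y l) \<noteq> 0"
        using det dist(1)[of l l] that by auto
      then show ?thesis
        using conic_matrix_minor[OF that, of x y] by auto
    qed
    have "i = 0 \<or> i = 1 \<or> i = 2" "j = 0 \<or> j = 1 \<or> j = 2"
      using that by linarith+
    then show ?thesis
      using that(3) minor[of 0 1 2] minor[of 1 2 0] minor[of 2 0 1]
        conic_matrix_sym[of x y 1 0] conic_matrix_sym[of x y 2 0] conic_matrix_sym[of x y 2 1]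
      by (elim disjE) (simp_all add: mult.commute)
  qed
  show "conic_matrix x y 0 0 * conic_matrix x y 1 1 * conic_matrix x y 2 2
      + 2 * conic_matrix x y 0 1 * conic_matrix x y 0 2 * conic_matrix x y 1 2
      - conic_matrix x y 0 0 * (conic_matrix x y 1 2)\<^sup>2 - conic_matrix x y 1 1 * (conic_matrix x y 0 2)\<^sup>2
      - conic_matrix x y 2 2 * (conic_matrix x y 0 1)\<^sup>2 \<noteq> 0"
    unfolding conic_matrix_det using det by simp
qed

text \<open>The determinant is affine in y 2 with slope s * x 2 - p, so two zeros give p = s * x 2.
  The determinant then factors and forces s = 0, hence p = 0: the quadratics 0 and 1 coincide,
  although x 1 is not a root of the former.\<close>

lemma quadratics_det_not_both_zero:
  fixes x y :: "nat \<Rightarrow> 'a::idom"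
  assumes zero: "quadratics_det x y = 0" "quadratics_det x (y(2 := z)) = 0" and "y 2 \<noteq> z"
    and dist: "x 2 \<noteq> x 0" "x 2 \<noteq> y 0" "x 2 \<noteq> x 1" "x 2 \<noteq> y 1" "x 1 \<noteq> x 0" "x 1 \<noteq> y 0"
  shows False
proof -
  define s where "s = x 1 + y 1 - (x 0 + y 0)"
  define p where "p = x 1 * y 1 - x 0 * y 0"
  have "quadratics_det x y - quadratics_det x (y(2 := z)) = (y 2 - z) * (s * x 2 - p)"
    by (simp add: quadratics_det_def s_def p_def algebra_simps)
  then have p: "p = s * x 2"
    using zero \<open>y 2 \<noteq> z\<close> by simp
  have "quadratics_det x y = s * (x 2 * y 2 - x 0 * y 0) - (x 2 + y 2 - (x 0 + y 0)) * p"
    by (simp add: quadratics_det_def s_def p_def)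
  also have "\<dots> = - s * ((x 2 - x 0) * (x 2 - y 0))"
    unfolding p by (simp add: algebra_simps)
  finally have "s = 0"
    using zero(1) dist(1,2) by simp
  moreover have "(x 1 - x 0) * (x 1 - y 0) = x 1 * s - p"
    by (simp add: s_def p_def algebra_simps)
  ultimately show False
    using dist(5,6) p by simp
qed

text \<open>X i = n^2 + s i * n b + p i * b^2 is the matrix with rows (1, s i, p i) applied to (n^2,
  n b, b^2); the adjugate returns this vector times the determinant.\<close>

lemma conic_matrix_apply:
  fixes x y :: "nat \<Rightarrow> 'a::comm_ring_1" and n b :: 'a
  defines "s \<equiv> \<lambda>i. x i + y i" and "p \<equiv> \<lambda>i. x i * y i"
  defines "X \<equiv> \<lambda>i. (n + x i * b) * (n + y i * b)"
  shows "cof s p 0 * X 0 + cof s p 1 * X 1 + cof s p 2 * X 2 = quadratics_det x y * n\<^sup>2"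
    and "- (cof (\<lambda>_. 1) p 0 * X 0 + cof (\<lambda>_. 1) p 1 * X 1 + cof (\<lambda>_. 1) p 2 * X 2) = quadratics_det x y * (n * b)"
    and "cof (\<lambda>_. 1) s 0 * X 0 + cof (\<lambda>_. 1) s 1 * X 1 + cof (\<lambda>_. 1) s 2 * X 2 = quadratics_det x y * b\<^sup>2"
  unfolding cof_simps quadratics_det_def s_def p_def X_def by (simp_all add: power2_eq_square algebra_simps)

lemma conic_matrix_point:
  fixes x y :: "nat \<Rightarrow> 'a::comm_ring_1" and n b :: 'a
  defines "X \<equiv> \<lambda>i. (n + x i * b) * (n + y i * b)"
  shows "(\<Sum>i\<le>2. \<Sum>j\<le>2. conic_matrix x y i j * (X i * X j)) = 0"
proof -
  define s p where "s = (\<lambda>i. x i + y i)" and "p = (\<lambda>i. x i * y i)"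
  define \<alpha> \<beta> \<gamma> where "\<alpha> = cof s p" and "\<beta> = (\<lambda>i. - cof (\<lambda>_. 1) p i)" and "\<gamma> = cof (\<lambda>_. 1) s"
  have q: "conic_matrix x y i j = 2 * \<beta> i * \<beta> j - \<alpha> i * \<gamma> j - \<alpha> j * \<gamma> i" for i j
    by (simp add: conic_matrix_def Let_def \<alpha>_def \<beta>_def \<gamma>_def s_def p_def)
  have "(\<Sum>i\<le>2. \<Sum>j\<le>2. conic_matrix x y i j * (X i * X j)) =
      2 * (\<beta> 0 * X 0 + \<beta> 1 * X 1 + \<beta> 2 * X 2)\<^sup>2 -
      2 * (\<alpha> 0 * X 0 + \<alpha> 1 * X 1 + \<alpha> 2 * X 2) * (\<gamma> 0 * X 0 + \<gamma> 1 * X 1 + \<gamma> 2 * X 2)"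
    unfolding q sum_atMost_2 by (simp add: power2_eq_square algebra_simps)
  also have "\<beta> 0 * X 0 + \<beta> 1 * X 1 + \<beta> 2 * X 2 = quadratics_det x y * (n * b)"
    using conic_matrix_apply(2)[of x y n b] unfolding \<beta>_def X_def p_def by simp
  also have "\<alpha> 0 * X 0 + \<alpha> 1 * X 1 + \<alpha> 2 * X 2 = quadratics_det x y * n\<^sup>2"
    unfolding \<alpha>_def X_def p_def s_def by (rule conic_matrix_apply)
  also have "\<gamma> 0 * X 0 + \<gamma> 1 * X 1 + \<gamma> 2 * X 2 = quadratics_det x y * b\<^sup>2"
    unfolding \<gamma>_def X_def s_def by (rule conic_matrix_apply)
  finally show ?thesis
    by (simp add: power2_eq_square)
qed

section \<open>From common neighbours to rational points\<close>

lemma mem_proj_point: "v \<in> proj_point v"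
  by (auto simp: proj_point_def coord_scale_def intro!: exI[of _ 1])

text \<open>Different b give different points: if two are proportional with factor c, applying the
  adjugate to their k-th powers compares n^2 with c^k n^2, so c^k = 1, and the second coordinate n b
  then recovers b. Here n \<noteq> 0 is essential.\<close>

lemma card_le_rational_points_conic:
  fixes x y :: "nat \<Rightarrow> nat" and n :: int and B :: "nat set" and k :: nat
  defines "F \<equiv> {conic_in_powers k (conic_matrix (\<lambda>i. rat_of_nat (x i)) (\<lambda>i. rat_of_nat (y i)))}"
  assumes k: "k \<ge> 1" and n: "n \<noteq> 0"
    and det: "quadratics_det (\<lambda>i. rat_of_nat (x i)) (\<lambda>i. rat_of_nat (y i)) \<noteq> 0"
    and powers: "\<And>i b. i \<le> 2 \<Longrightarrow> b \<in> B \<Longrightarrow> \<exists>z\<ge>1. int (x i) * int b + n = int (z ^ k)"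
      "\<And>i b. i \<le> 2 \<Longrightarrow> b \<in> B \<Longrightarrow> \<exists>z\<ge>1. int (y i) * int b + n = int (z ^ k)"
    and fin: "finite (rational_points 2 F)"
  shows "card B \<le> card (rational_points 2 F)"
proof -
  define D where "D = quadratics_det (\<lambda>i. rat_of_nat (x i)) (\<lambda>i. rat_of_nat (y i))"
  obtain z where z: "\<And>i b. i \<le> 2 \<Longrightarrow> b \<in> B \<Longrightarrow> z i b \<ge> 1 \<and> int (x i) * int b + n = int (z i b ^ k)"
    using powers(1) by metis
  obtain w where w: "\<And>i b. i \<le> 2 \<Longrightarrow> b \<in> B \<Longrightarrow> w i b \<ge> 1 \<and> int (y i) * int b + n = int (w i b ^ k)"
    using powers(2) by metis
  define v where "v b i = (if i \<le> 2 then rat_of_nat (z i b * w i b) else 0)" for b i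
  define N where "N = rat_of_int n"
  have N: "N \<noteq> 0"
    using n by (simp add: N_def)
  define X where "X b i = (N + rat_of_nat (x i) * rat_of_nat b) * (N + rat_of_nat (y i) * rat_of_nat b)" for b i
  define \<alpha> where "\<alpha> = cof (\<lambda>i. rat_of_nat (x i) + rat_of_nat (y i)) (\<lambda>i. rat_of_nat (x i) * rat_of_nat (y i))"
  define \<beta> where "\<beta> = cof (\<lambda>_. 1) (\<lambda>i. rat_of_nat (x i) * rat_of_nat (y i))"
  have apply1: "\<alpha> 0 * X b 0 + \<alpha> 1 * X b 1 + \<alpha> 2 * X b 2 = D * N\<^sup>2" for b
    unfolding \<alpha>_def X_def D_def by (rule conic_matrix_apply)
  have apply2: "- (\<beta> 0 * X b 0 + \<beta> 1 * X b 1 + \<beta> 2 * X b 2) = D * (N * rat_of_nat b)" for b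
    unfolding \<beta>_def X_def D_def by (rule conic_matrix_apply)
  have v_pow: "v b i ^ k = X b i" if "i \<le> 2" "b \<in> B" for b i
  proof -
    have "rat_of_nat (z i b ^ k) = rat_of_int (int (x i) * int b + n)"
      "rat_of_nat (w i b ^ k) = rat_of_int (int (y i) * int b + n)"
      using z[OF that] w[OF that] by (metis of_int_of_nat_eq)+
    then show ?thesis
      using that by (simp add: v_def X_def N_def power_mult_distrib add.commute)
  qed
  have "v b \<in> affine_cone 2 F" if "b \<in> B" for b
  proof -
    have "eval_mvpoly (conic_in_powers k (conic_matrix (\<lambda>i. rat_of_nat (x i)) (\<lambda>i. rat_of_nat (y i)))) (v b) = 0"
      using conic_matrix_point[of "\<lambda>i. rat_of_nat (x i)" "\<lambda>i. rat_of_nat (y i)" N "rat_of_nat b"]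
      by (simp add: eval_conic_in_powers v_pow[OF _ that] X_def sum_atMost_2)
    moreover have "v b 0 \<noteq> 0"
      using z[of 0, OF _ that] w[of 0, OF _ that] by (simp add: v_def)
    then have "v b \<noteq> (\<lambda>_. 0)"
      by auto
    moreover have "v b i = 0" if "i > 2" for i
      using that by (simp add: v_def)
    ultimately show ?thesis
      by (simp add: affine_cone_def F_def)
  qed
  then have sub: "(\<lambda>b. proj_point (v b)) ` B \<subseteq> rational_points 2 F"
    by (auto simp: rational_points_def proj_zeros_def)
  have "inj_on (\<lambda>b. proj_point (v b)) B"
  proof (rule inj_onI)
    fix b b' assume b: "b \<in> B" "b' \<in> B" "proj_point (v b) = proj_point (v b')"
    then have "v b \<in> proj_point (v b')"
      using mem_proj_point[of "v b"] by simp
    then obtain c where c: "v b = coord_scale c (v b')"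
      by (auto simp: proj_point_def)
    have X: "X b i = c ^ k * X b' i" if "i \<le> 2" for i
      using that b by (simp add: v_pow[symmetric] c coord_scale_def power_mult_distrib)
    have "D * N\<^sup>2 = \<alpha> 0 * X b 0 + \<alpha> 1 * X b 1 + \<alpha> 2 * X b 2"
      by (rule apply1[symmetric])
    also have "\<dots> = c ^ k * (\<alpha> 0 * X b' 0 + \<alpha> 1 * X b' 1 + \<alpha> 2 * X b' 2)"
      by (simp add: X algebra_simps)
    also have "\<dots> = c ^ k * (D * N\<^sup>2)"
      by (simp only: apply1)
    finally have "D * N\<^sup>2 = c ^ k * (D * N\<^sup>2)" .
    then have "c ^ k = 1"
      using det N by (simp add: D_def)
    then have "D * (N * rat_of_nat b) = D * (N * rat_of_nat b')"
      unfolding apply2[symmetric] by (simp add: X)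
    then show "b = b'"
      using det N by (simp add: D_def)
  qed
  then have "card B = card ((\<lambda>b. proj_point (v b)) ` B)"
    by (simp add: card_image)
  also have "\<dots> \<le> card (rational_points 2 F)"
    by (rule card_mono[OF fin sub])
  finally show ?thesis .
qed

text \<open>The genus depends on k alone, so a single constant serves all matrices q.\<close>

lemma uniformity_conic_in_powers:
  assumes "uniformity_conjecture" "k \<ge> 2"
  shows "\<exists>C. \<forall>q. principal_minors_nonzero q \<longrightarrow>
    finite (rational_points 2 {conic_in_powers k q}) \<and> card (rational_points 2 {conic_in_powers k q}) \<le> C"
proof -
  have "1 * 2 \<le> (k - 1) * (2 * k - 1)"
    using assms(2) by (intro mult_mono) auto
  then have "(2 * k - 1) * (k - 1) \<ge> 2"
    by (simp add: mult.commute)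
  then obtain C where "\<And>N F. smooth_projective_curve N F \<Longrightarrow> has_arithmetic_genus N F (int ((2 * k - 1) * (k - 1))) \<Longrightarrow>
      finite (rational_points N F) \<and> card (rational_points N F) \<le> C"
    using assms(1) unfolding uniformity_conjecture_def by blast
  then show ?thesis
    using smooth_projective_curve_conic_in_powers[OF assms(2)] by blast
qed

lemma uniformity_common_neighbours:
  assumes "uniformity_conjecture" "k \<ge> 2"
  shows "\<exists>C. \<forall>(n::int) (S::nat set) (B::nat set). n \<noteq> 0 \<longrightarrow> card S = 7 \<longrightarrow>
    (\<forall>b\<in>B. \<forall>s\<in>S. \<exists>z\<ge>1. int s * int b + n = int (z ^ k)) \<longrightarrow> card B \<le> C"
proof -
  obtain C where C: "\<And>q. principal_minors_nonzero q \<Longrightarrow>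
      finite (rational_points 2 {conic_in_powers k q}) \<and> card (rational_points 2 {conic_in_powers k q}) \<le> C"
    using uniformity_conic_in_powers[OF assms] by blast
  have "card B \<le> C" if n: "n \<noteq> 0" and S: "card S = 7"
    and B: "\<And>b s. b \<in> B \<Longrightarrow> s \<in> S \<Longrightarrow> \<exists>z\<ge>1. int s * int b + n = int (z ^ k)" for n :: int and S B :: "nat set"
  proof -
    have "finite S"
      using S by (metis card.infinite zero_neq_numeral)
    then obtain xs where xs: "set xs = S" "distinct xs"
      using finite_distinct_list by blast
    then have len: "length xs = 7"
      using S distinct_card by fastforce
    have mem: "xs ! i \<in> S" if "i < 7" for i
      using xs len that by (metis nth_mem)
    have neq: "xs ! i \<noteq> xs ! j" if "i < 7" "j < 7" "i \<noteq> j" for i j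
      using xs len that by (simp add: nth_eq_iff_index_eq)
    \<comment> \<open>The pairs are the entries (0, 1), (2, 3) and (4, m) of the list, with m = 5 or
      the spare entry m = 6.\<close>
    define x :: "nat \<Rightarrow> nat" where "x i = xs ! (2 * i)" for i
    define y :: "nat \<Rightarrow> nat \<Rightarrow> nat" where "y m i = (if i = 2 then xs ! m else xs ! (2 * i + 1))" for m i
    have "\<exists>m\<in>{5, 6}. quadratics_det (\<lambda>i. rat_of_nat (x i)) (\<lambda>i. rat_of_nat (y m i)) \<noteq> 0"
    proof (rule ccontr)
      assume "\<not> ?thesis"
      then have zero: "quadratics_det (\<lambda>i. rat_of_nat (x i)) (\<lambda>i. rat_of_nat (y 5 i)) = 0"
        "quadratics_det (\<lambda>i. rat_of_nat (x i)) (\<lambda>i. rat_of_nat (y 6 i)) = 0"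
        by auto
      have upd: "(\<lambda>i. rat_of_nat (y 6 i)) = (\<lambda>i. rat_of_nat (y 5 i))(2 := rat_of_nat (xs ! 6))"
        by (auto simp: y_def fun_eq_iff)
      show False
        by (rule quadratics_det_not_both_zero[OF zero(1) zero(2)[unfolded upd]])
           (simp_all add: x_def y_def neq)
    qed
    then obtain m where m: "m = 5 \<or> m = 6"
      and det: "quadratics_det (\<lambda>i. rat_of_nat (x i)) (\<lambda>i. rat_of_nat (y m i)) \<noteq> 0"
      by blast
    have idx: "i = 0 \<or> i = 1 \<or> i = 2" if "i \<le> 2" for i :: nat
      using that by linarith
    have "principal_minors_nonzero (conic_matrix (\<lambda>i. rat_of_nat (x i)) (\<lambda>i. rat_of_nat (y m i)))"
    proof (rule principal_minors_conic_matrix[OF det])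
      fix i j :: nat assume ij: "i \<le> 2" "j \<le> 2"
      show "rat_of_nat (x i) \<noteq> rat_of_nat (y m j)"
        using idx[OF ij(1)] idx[OF ij(2)] m unfolding of_nat_eq_iff x_def y_def
        by (elim disjE) (simp_all add: neq)
      show "rat_of_nat (x i) \<noteq> rat_of_nat (x j) \<and> rat_of_nat (y m i) \<noteq> rat_of_nat (y m j)" if "i \<noteq> j"
        using idx[OF ij(1)] idx[OF ij(2)] m that unfolding of_nat_eq_iff x_def y_def
        by (elim disjE) (simp_all add: neq)
    qed
    note C = C[OF this]
    have "x i \<in> S" "y m i \<in> S" if "i \<le> 2" for i
      using idx[OF that] m by (auto simp: x_def y_def mem)
    then have "card B \<le> card (rational_points 2
        {conic_in_powers k (conic_matrix (\<lambda>i. rat_of_nat (x i)) (\<lambda>i. rat_of_nat (y m i)))})"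
      using assms(2) C B by (intro card_le_rational_points_conic[OF _ n det]) simp_all
    then show ?thesis
      using C by linarith
  qed
  then show ?thesis by blast
qed

section \<open>Diophantine tuples\<close>

lemma property_D_imp_prime_power:
  assumes "property_D (enat d) n A" "a \<in> A" "b \<in> A" "a \<noteq> b"
  shows "\<exists>p. prime p \<and> p \<le> d \<and> (\<exists>z\<ge>1. int a * int b + n = int (z ^ p))"
proof -
  obtain x k where k: "int a * int b + n = int (x ^ k)" "x \<ge> 1" "2 \<le> k" "k \<le> d"
    using assms unfolding property_D_def V_def by force
  obtain p where p: "prime p" "p dvd k"
    using prime_factor_nat[of k] k(3) by auto
  then obtain m where m: "k = p * m"
    by (elim dvdE)
  have "p \<le> k"
    using p(2) k(3) by (intro dvd_imp_le) auto
  moreover have "x ^ k = (x ^ m) ^ p"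
    by (simp add: m mult.commute flip: power_mult)
  ultimately show ?thesis
    using p(1) k by (intro exI[of _ p]) (auto intro!: exI[of _ "x ^ m"])
qed

lemma property_D_subset: "property_D d n A \<Longrightarrow> B \<subseteq> A \<Longrightarrow> property_D d n B"
  unfolding property_D_def by blast

lemma card_primes_below_25: "card {p::nat. prime p \<and> p \<le> d \<and> p < 25} \<le> 9"
proof -
  have "{p::nat. prime p \<and> p \<le> d \<and> p < 25} \<subseteq> {2, 3, 5, 7, 11, 13, 17, 19, 23}"
  proof
    fix p :: nat assume "p \<in> {p. prime p \<and> p \<le> d \<and> p < 25}"
    then have p: "prime p" "p < 25"
      by auto
    have dvd: "2 dvd p \<longrightarrow> p = 2" "3 dvd p \<longrightarrow> p = 3" "p \<noteq> 0" "p \<noteq> 1"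
      using p(1) by (auto simp: prime_nat_iff)
    \<comment> \<open>Below 25 = 5^2 every number greater than 1 and prime to 6 is prime, so
      divisibility by 2 and 3 decides all cases.\<close>
    have "p = 6 * (p div 6) + p mod 6"
      by simp
    moreover have "p div 6 = 0 \<or> p div 6 = 1 \<or> p div 6 = 2 \<or> p div 6 = 3 \<or> p div 6 = 4"
      using p(2) by linarith
    moreover have "p mod 6 = 0 \<or> p mod 6 = 1 \<or> p mod 6 = 2 \<or> p mod 6 = 3 \<or> p mod 6 = 4 \<or> p mod 6 = 5"
      by linarith
    ultimately show "p \<in> {2, 3, 5, 7, 11, 13, 17, 19, 23}"
      using dvd p(2) by (elim disjE) simp_all
  qed
  from card_mono[OF _ this] show ?thesis
    by simp
qed

lemma uniformity_common_neighbours_uniform: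
  assumes "uniformity_conjecture"
  shows "\<exists>C. \<forall>k (n::int) (S::nat set) (B::nat set). 2 \<le> k \<longrightarrow> k < m \<longrightarrow> n \<noteq> 0 \<longrightarrow> card S = 7 \<longrightarrow>
    (\<forall>b\<in>B. \<forall>s\<in>S. \<exists>z\<ge>1. int s * int b + n = int (z ^ k)) \<longrightarrow> card B \<le> C"
proof -
  have "\<forall>k. \<exists>C. 2 \<le> k \<longrightarrow> (\<forall>(n::int) (S::nat set) (B::nat set). n \<noteq> 0 \<longrightarrow> card S = 7 \<longrightarrow>
    (\<forall>b\<in>B. \<forall>s\<in>S. \<exists>z\<ge>1. int s * int b + n = int (z ^ k)) \<longrightarrow> card B \<le> C)"
    using uniformity_common_neighbours[OF assms] by blast
  then obtain C where C: "\<And>k (n::int) (S::nat set) (B::nat set). 2 \<le> k \<Longrightarrow> n \<noteq> 0 \<Longrightarrow> card S = 7 \<Longrightarrow>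
    (\<forall>b\<in>B. \<forall>s\<in>S. \<exists>z\<ge>1. int s * int b + n = int (z ^ k)) \<Longrightarrow> card B \<le> C k"
    by metis
  have "C k \<le> (\<Sum>k<m. C k)" if "k < m" for k
    using that by (intro member_le_sum) auto
  then show ?thesis
    using C by (meson order_trans)
qed

lemma property_D_card_le:
  assumes unif: "uniformity_conjecture" and lps: "lander_parkin_selfridge_special"
  shows "\<exists>C\<ge>0. \<forall>(d::nat) (n::int) A. d \<ge> 2 \<longrightarrow> n \<noteq> 0 \<longrightarrow> finite A \<longrightarrow> A \<subseteq> {1..} \<longrightarrow> property_D (enat d) n A \<longrightarrow>
    real (card A) \<le> C * (real d / ln (real d))\<^sup>2"
proof -
  obtain c where c: "\<And>k (n::int) (S::nat set) (B::nat set). 2 \<le> k \<Longrightarrow> k < 25 \<Longrightarrow> n \<noteq> 0 \<Longrightarrow> card S = 7 \<Longrightarrow>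
      (\<forall>b\<in>B. \<forall>s\<in>S. \<exists>z\<ge>1. int s * int b + n = int (z ^ k)) \<Longrightarrow> card B \<le> c"
    using uniformity_common_neighbours_uniform[OF unif, of 25] by blast
  define t where "t = c + 2794"
  define K where "K = 20 * (9 * (real t * 147 ^ 7) + 1)"
  have "K \<ge> 0"
    by (simp add: K_def)
  have "real (card A) \<le> (K + 4 * (1 + real t)\<^sup>2 * 36) * (real d / ln (real d))\<^sup>2"
    if d: "d \<ge> 2" and n: "n \<noteq> 0" and A: "finite A" "A \<subseteq> {1..}" "property_D (enat d) n A"
    for d :: nat and n :: int and A
  proof -
    define E where "E p a b \<longleftrightarrow> a \<noteq> b \<and> (\<exists>z\<ge>1. int a * int b + n = int (z ^ p))" for p a b
    define P where "P = {p::nat. prime p \<and> p \<le> d \<and> p < 25}"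
    define Q where "Q = {p::nat. prime p \<and> p \<le> d \<and> p \<ge> 25}"
    have fin: "finite {p::nat. prime p \<and> p \<le> d}"
      by (rule finite_subset[of _ "{..d}"]) auto
    have finPQ: "finite P" "finite Q"
      unfolding P_def Q_def by (auto intro: finite_subset[OF _ fin])
    have "real (card A) \<le> 20 * (9 * (real t * 147 ^ 7) + 1) + 4 * (1 + real t)\<^sup>2 * (real (card Q))\<^sup>2"
    proof (rule edge_coloured_clique_card_le[OF A(1) finPQ(1) _ finPQ(2)])
      show "card P \<le> 9"
        unfolding P_def by (rule card_primes_below_25)
      show "t \<ge> 1"
        by (simp add: t_def)
    next
      fix a b assume ab: "a \<in> A" "b \<in> A" "a \<noteq> b"
      obtain p where p: "prime p" "p \<le> d" "E p a b"
        using property_D_imp_prime_power[OF A(3) ab] ab(3) unfolding E_def by blast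
      then have "p \<in> P \<union> Q"
        by (auto simp: P_def Q_def)
      then show "\<exists>p\<in>P \<union> Q. E p a b"
        using p(3) by blast
    next
      fix p S assume p: "p \<in> P" and S: "S \<subseteq> A" "card S = 7"
      have "card {v\<in>A. \<forall>s\<in>S. E p s v} \<le> c"
        using p prime_ge_2_nat[of p] by (intro c[OF _ _ n S(2)]) (auto simp: P_def E_def)
      then show "card {v\<in>A. \<forall>s\<in>S. E p s v} \<le> t"
        by (simp add: t_def)
    next
      fix p S assume p: "p \<in> Q" and S: "S \<subseteq> A" "card S = 2"
      obtain a a' where a: "S = {a, a'}" "a \<noteq> a'"
        using S(2) by (auto simp: card_2_iff)
      have "card {v\<in>A. \<forall>s\<in>S. E p s v} \<le> 2794"
      proof (rule lander_parkin_selfridge_common_neighbours[OF lps _ n a(2)])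
        show "p \<ge> 25"
          using p by (simp add: Q_def)
        show "a > 0" "a' > 0"
          using S(1) A(2) a(1) by auto
        show "finite {v\<in>A. \<forall>s\<in>S. E p s v}"
          using A(1) by simp
        fix b assume "b \<in> {v\<in>A. \<forall>s\<in>S. E p s v}"
        then have "E p a b" "E p a' b"
          by (simp_all add: a(1))
        then show "\<exists>z\<ge>1. int a * int b + n = int (z ^ p)" "\<exists>z\<ge>1. int a' * int b + n = int (z ^ p)"
          by (simp_all add: E_def)
      qed
      then show "card {v\<in>A. \<forall>s\<in>S. E p s v} \<le> t"
        by (simp add: t_def)
    qed
    then have "real (card A) \<le> K + 4 * (1 + real t)\<^sup>2 * (real (card Q))\<^sup>2"
      by (simp add: K_def)
    also have "(real (card Q))\<^sup>2 \<le> (6 * (d / ln d))\<^sup>2"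
    proof (rule power_mono)
      have "card Q \<le> card {p::nat. prime p \<and> p \<le> d}"
        unfolding Q_def by (rule card_mono[OF fin]) auto
      then show "real (card Q) \<le> 6 * (d / ln d)"
        using prime_count_le[OF d] by linarith
    qed simp
    also have "K + 4 * (1 + real t)\<^sup>2 * (6 * (d / ln d))\<^sup>2 \<le>
        K * (d / ln d)\<^sup>2 + 4 * (1 + real t)\<^sup>2 * (6 * (d / ln d))\<^sup>2"
    proof -
      \<comment> \<open>As d / ln d \<ge> 1, the additive constant \<open>K\<close> can be absorbed
        into the main term.\<close>
      have "ln (real d) \<le> d"
        using ln_le_minus_one[of "real d"] d by simp
      then have "1 \<le> d / ln d"
        using d by simp
      then have "1 \<le> (d / ln d)\<^sup>2"
        by (rule one_le_power)
      then show ?thesis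
        using mult_left_mono[OF _ \<open>K \<ge> 0\<close>] by fastforce
    qed
    finally have "real (card A) \<le> K * (d / ln d)\<^sup>2 + 4 * (1 + real t)\<^sup>2 * (6 * (d / ln d))\<^sup>2"
      by (simp add: mult_left_mono)
    also have "\<dots> = (K + 4 * (1 + real t)\<^sup>2 * 36) * (d / ln d)\<^sup>2"
      unfolding power_mult_distrib by (simp add: algebra_simps)
    finally show ?thesis .
  qed
  moreover have "K + 4 * (1 + real t)\<^sup>2 * 36 \<ge> 0"
    using \<open>K \<ge> 0\<close> by simp
  ultimately show ?thesis by blast
qed

text \<open>Bounds for finite sets suffice: the property passes to subsets, and an infinite set
  would contain a finite one exceeding R.\<close>

lemma M_le:
  assumes "\<And>A. finite A \<Longrightarrow> A \<subseteq> {1..} \<Longrightarrow> property_D d n A \<Longrightarrow> real (card A) \<le> R"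
  shows "ereal_of_enat (M d n) \<le> ereal R"
proof -
  have "R \<ge> 0"
    using assms[of "{}"] by (simp add: property_D_def)
  have le: "card A \<le> nat \<lfloor>R\<rfloor>" if "finite A" "A \<subseteq> {1..}" "property_D d n A" for A
    using assms[OF that] by (rule le_nat_floor)
  have "M d n \<le> enat (nat \<lfloor>R\<rfloor>)"
    unfolding M_def
  proof (rule SUP_least)
    fix A assume "A \<in> {A. A \<subseteq> {1..} \<and> property_D d n A}"
    then have A: "A \<subseteq> {1..}" "property_D d n A"
      by auto
    have "finite A"
    proof (rule ccontr)
      assume "infinite A"
      then obtain B where "B \<subseteq> A" "finite B" "card B = Suc (nat \<lfloor>R\<rfloor>)"
        using infinite_arbitrarily_large by blast
      moreover from this have "card B \<le> nat \<lfloor>R\<rfloor>"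
        using A(1) by (intro le property_D_subset[OF A(2)]) auto
      ultimately show False
        by simp
    qed
    then show "ecard A \<le> enat (nat \<lfloor>R\<rfloor>)"
      using le A by (simp add: ecard_def)
  qed
  then have "ereal_of_enat (M d n) \<le> ereal_of_enat (enat (nat \<lfloor>R\<rfloor>))"
    by (simp only: ereal_of_enat_le_iff)
  also have "\<dots> = ereal (real (nat \<lfloor>R\<rfloor>))"
    by simp
  also have "\<dots> \<le> ereal R"
    using \<open>R \<ge> 0\<close> of_nat_floor by simp
  finally show ?thesis .
qed

text \<open>The values a b + n are at most 2 x^2, so an exponent k with base at least 2 satisfies (k
  - 1) ln 2 \<le> 2 ln x. With ln 2 \<ge> 2/3 this gives k \<le> 3 ln x + 1 \<le> 5 ln x.\<close>

lemma property_D_infinity_imp_bounded: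
  assumes A: "property_D \<infinity> n A" "\<And>a. a \<in> A \<Longrightarrow> real a \<le> x" and n: "real_of_int \<bar>n\<bar> \<le> x"
    and x: "x \<ge> exp 2" and d: "d = nat \<lfloor>5 * ln x\<rfloor>"
  shows "property_D (enat d) n A"
  unfolding property_D_def
proof (intro ballI impI)
  fix a b assume ab: "a \<in> A" "b \<in> A" "a \<noteq> b"
  have "x > 0"
    using x by (meson exp_gt_zero less_le_trans)
  have "2 \<le> ln x"
    using x \<open>x > 0\<close> by (simp add: ln_ge_iff)
  then have "x \<ge> 1"
    using \<open>x > 0\<close> ln_le_minus_one[of x] by simp
  obtain z k where zk: "int a * int b + n = int (z ^ k)" "z \<ge> 1" "k \<ge> 2"
    using A(1) ab unfolding property_D_def V_def by force
  have "2 \<le> d"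
    unfolding d using \<open>2 \<le> ln x\<close> by (intro le_nat_floor) simp
  have "\<exists>y l. z ^ k = y ^ l \<and> y \<ge> 1 \<and> 2 \<le> l \<and> l \<le> d"
  proof (cases "z = 1")
    \<comment> \<open>The value 1 bounds no exponent; it is rewritten as 1^2.\<close>
    case True
    then show ?thesis
      using \<open>2 \<le> d\<close> by (intro exI[of _ 1] exI[of _ 2]) simp
  next
    case False
    then have "(2::real) ^ k \<le> real z ^ k"
      using zk(2) by (intro power_mono) auto
    also have "\<dots> = real_of_int (int (z ^ k))"
      by simp
    also have "\<dots> = real a * real b + real_of_int n"
      unfolding zk(1)[symmetric] by simp
    also have "\<dots> \<le> x * x + x * x"
    proof (intro add_mono mult_mono)
      have "real_of_int n \<le> x"
        using n by linarith
      also have "\<dots> \<le> x * x"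
        using \<open>x \<ge> 1\<close> by simp
      finally show "real_of_int n \<le> x * x" .
    qed (use A(2) ab \<open>x > 0\<close> in auto)
    finally have "ln ((2::real) ^ k) \<le> ln (2 * (x * x))"
      by (intro ln_mono) auto
    then have "real k * ln 2 \<le> ln 2 + 2 * ln x"
      using \<open>x > 0\<close> by (simp add: ln_realpow ln_mult)
    then have "(real k - 1) * ln 2 \<le> 2 * ln x"
      by (simp add: algebra_simps)
    moreover have "(real k - 1) * (2 / 3) \<le> (real k - 1) * ln 2"
      using zk(3) ln2_ge_two_thirds by (intro mult_left_mono) auto
    ultimately have "real k \<le> 5 * ln x"
      using \<open>2 \<le> ln x\<close> by simp
    then have "k \<le> d"
      unfolding d by (rule le_nat_floor)
    then show ?thesis
      using zk(2,3) by blast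
  qed
  then obtain y l where "z ^ k = y ^ l" "y \<ge> 1" "2 \<le> l" "l \<le> d"
    by blast
  then show "int a * int b + n \<in> int ` V (enat d)"
    unfolding zk(1) V_def by (intro image_eqI[of _ _ "z ^ k"]) auto
qed

text \<open>\<open>Max\<close> is meaningful for a finite nonempty set: the cardinalities are
  bounded by the number of integers up to x, and the empty tuple with n = 1 is admissible because x
  \<ge> 1.\<close>

lemma f_tilde_le:
  assumes "x \<ge> 1"
    and "\<And>A n. A \<subseteq> {a. 1 \<le> a \<and> real a \<le> x} \<Longrightarrow> 1 \<le> \<bar>n\<bar> \<Longrightarrow> real_of_int \<bar>n\<bar> \<le> x \<Longrightarrow> property_D \<infinity> n A \<Longrightarrow>
      real (card A) \<le> R"
  shows "real (f_tilde x) \<le> R"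
proof -
  define S where "S = {card A | A n. A \<subseteq> {a. 1 \<le> a \<and> real a \<le> x} \<and>
    1 \<le> \<bar>n\<bar> \<and> real_of_int \<bar>n\<bar> \<le> x \<and> property_D \<infinity> n A}"
  have fin: "finite {a::nat. 1 \<le> a \<and> real a \<le> x}"
    by (rule finite_subset[of _ "{..nat \<lfloor>x\<rfloor>}"]) (auto intro: le_nat_floor)
  have "S \<subseteq> {..card {a::nat. 1 \<le> a \<and> real a \<le> x}}"
    using card_mono[OF fin] by (auto simp: S_def)
  then have "finite S"
    by (rule finite_subset) simp
  moreover have "card {} \<in> S"
    unfolding S_def using assms(1) by (intro CollectI exI[of _ "{}"] exI[of _ 1]) (auto simp: property_D_def)
  ultimately have "Max S \<in> S"
    by (intro Max_in) auto
  then obtain A n where "Max S = card A" "A \<subseteq> {a. 1 \<le> a \<and> real a \<le> x}"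
    "1 \<le> \<bar>n\<bar>" "real_of_int \<bar>n\<bar> \<le> x" "property_D \<infinity> n A"
    unfolding S_def by blast
  then have "real (Max S) \<le> R"
    using assms(2) by simp
  then show ?thesis
    by (simp add: f_tilde_def S_def)
qed

theorem theorem2p14:
  assumes "uniformity_conjecture"
    and "lander_parkin_selfridge_special"
  shows "(\<exists>C'::real. \<forall>(d::nat) (n::int). d \<ge> 2 \<and> n \<noteq> 0 \<longrightarrow>
            ereal_of_enat (M (enat d) n) \<le> ereal (C' * (real d / ln (real d))\<^sup>2)) \<and>
         (\<exists>C''::real. \<forall>\<^sub>F x::real in at_top.
            real (f_tilde x) \<le> C'' * (ln x / ln (ln x))\<^sup>2)"
proof -
  obtain C where C: "C \<ge> 0" "\<And>(d::nat) (n::int) A. d \<ge> 2 \<Longrightarrow> n \<noteq> 0 \<Longrightarrow> finite A \<Longrightarrow> A \<subseteq> {1..} \<Longrightarrow>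
      property_D (enat d) n A \<Longrightarrow> real (card A) \<le> C * (real d / ln (real d))\<^sup>2"
    using property_D_card_le[OF assms] by blast
  have "ereal_of_enat (M (enat d) n) \<le> ereal (C * (real d / ln (real d))\<^sup>2)" if "d \<ge> 2 \<and> n \<noteq> 0" for d n
    using that C(2) by (intro M_le) auto
  moreover have "\<forall>\<^sub>F x::real in at_top. real (f_tilde x) \<le> 25 * C * (ln x / ln (ln x))\<^sup>2"
    using eventually_ge_at_top[of "exp 2"]
  proof eventually_elim
    case (elim x)
    define d where "d = nat \<lfloor>5 * ln x\<rfloor>"
    have "x > 0"
      using elim by (meson exp_gt_zero less_le_trans)
    have "2 \<le> ln x"
      using elim \<open>x > 0\<close> by (simp add: ln_ge_iff)
    then have "x \<ge> 1"
      using \<open>x > 0\<close> ln_le_minus_one[of x] by simp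
    \<comment> \<open>The lower bound uses 5 ln x - 1 \<ge> ln x. Thus d is ln x up to a factor 5,
      and the numerator and denominator of d / ln d are estimated separately; the square of 5
      becomes the 25 in the constant.\<close>
    have d: "real d \<le> 5 * ln x" "ln x \<le> real d"
      using \<open>2 \<le> ln x\<close> unfolding d_def by linarith+
    have ln_ln: "0 < ln (ln x)" "ln (ln x) \<le> ln (real d)"
      using \<open>2 \<le> ln x\<close> d by (auto intro!: ln_mono)
    have "d \<ge> 2"
      using d(2) \<open>2 \<le> ln x\<close> by linarith
    have "real d / ln (real d) \<le> 5 * ln x / ln (ln x)"
      using d ln_ln \<open>2 \<le> ln x\<close> by (intro frac_le) auto
    then have "(real d / ln (real d))\<^sup>2 \<le> (5 * ln x / ln (ln x))\<^sup>2"
      using \<open>d \<ge> 2\<close> by (intro power_mono) auto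
    also have "\<dots> = 25 * (ln x / ln (ln x))\<^sup>2"
      by (simp add: power_divide power_mult_distrib)
    finally have "C * (real d / ln (real d))\<^sup>2 \<le> C * (25 * (ln x / ln (ln x))\<^sup>2)"
      using C(1) by (rule mult_left_mono)
    then have le: "C * (real d / ln (real d))\<^sup>2 \<le> 25 * C * (ln x / ln (ln x))\<^sup>2"
      by simp
    show ?case
    proof (rule f_tilde_le[OF \<open>x \<ge> 1\<close>])
      fix A n
      assume A: "A \<subseteq> {a. 1 \<le> a \<and> real a \<le> x}" and n: "1 \<le> \<bar>n\<bar>" "real_of_int \<bar>n\<bar> \<le> x" and D: "property_D \<infinity> n A"
      have "finite A"
        using A by (rule finite_subset[OF _ finite_subset[of _ "{..nat \<lfloor>x\<rfloor>}"]]) (auto intro: le_nat_floor)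
      moreover have "property_D (enat d) n A"
        using A by (intro property_D_infinity_imp_bounded[OF D _ n(2) elim d_def]) auto
      ultimately have "real (card A) \<le> C * (real d / ln (real d))\<^sup>2"
        using \<open>d \<ge> 2\<close> n(1) A by (intro C(2)) auto
      then show "real (card A) \<le> 25 * C * (ln x / ln (ln x))\<^sup>2"
        using le by linarith
    qed
  qed
  ultimately show ?thesis by blast
qed

end
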